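(* Let $m\geq 3$ and let $k$ be any nonzero real number. There does not exist any non-Hopf real hypersurface $M$ in the complex quadric $Q^m$ such that $L_{\xi_T}^{(k)}(\xi,X)=0$ for any $X$ tangent to $M$.
   Context: The complex quadric $Q^m=SO_{m+2}/SO_mSO_2$ is the complex hypersurface $z_1^2+\cdots+z_{m+2}^2=0$ in $\mathbb{C}P^{m+1}$, with the Kähler structure $(J,G)$ induced from $\mathbb{C}P^{m+1}$ with the Fubini-Study metric. Let $M$ be a real hypersurface (real codimension one) in $Q^m$ with induced metric $g$, Levi-Civita connection $\nabla$, local unit normal vector field $N$, and shape operator $S$ with respect to $N$ ($SX=-\bar\nabla_XN$, $\bar\nabla$ the Levi-Civita connection of $Q^m$). The Reeb vector field is $\xi=-JN$, $\eta(X)=g(X,\xi)$, and $\phi X$ is the tangential part of $JX$, i.e. $JX=\phi X+\eta(X)N$ for $X$ tangent to $M$. $M$ is called Hopf if the Reeb vector field is principal, that is, $S\xi=\alpha\xi$ for some function $\alpha$ on $M$; otherwise $M$ is non-Hopf. For a nonzero real number $k$, the $k$-th generalized Tanaka-Webster connection on $M$ is $\hat\nabla^{(k)}_XY=\nabla_XY+F_X^{(k)}Y$, where the $k$-th Cho operator is $$F_X^{(k)}Y=g(\phi SX,Y)\xi-\eta(Y)\phi SX-k\eta(X)\phi Y .$$ The $k$-th torsion operator associated to $X$ is $T_X^{(k)}Y=F_X^{(k)}Y-F_Y^{(k)}X$. The structure Lie operator $L_\xi$ of $M$ is the symmetric operator defined by $g(L_\xi X,Y)=(\mathcal{L}_\xi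 g)(X,Y)$ ($\mathcal{L}$ the Lie derivative), that is, $L_\xi X=(\phi S-S\phi)X$. The tensor field $L_{\xi_T}^{(k)}$ of type $(1,2)$ on $M$ is $$L_{\xi_T}^{(k)}(X,Y)=T_X^{(k)}L_\xi Y-L_\xi T_X^{(k)}Y$$ for $X,Y$ tangent to $M$. *)

theory Defs
  imports "HOL-Analysis.Analysis"
begin

section \<open>Smooth maps and embedded submanifolds of a Euclidean space\<close>

text \<open>Only used for open \<open>S\<close> in a finite-dimensional space, where the existence and continuity of
  all iterated directional derivatives is the same as being of class \<open>C\<^sup>k\<close>.\<close>

primrec Ck_on :: "nat \<Rightarrow> 'a::euclidean_space set \<Rightarrow> ('a \<Rightarrow> 'b::real_normed_vector) \<Rightarrow> bool" where
  "Ck_on 0 S f \<longleftrightarrow> continuous_on S f"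
| "Ck_on (Suc n) S f \<longleftrightarrow>
     f differentiable_on S \<and> (\<forall>v. Ck_on n S (\<lambda>x. frechet_derivative f (at x) v))"

definition smooth_on :: "'a::euclidean_space set \<Rightarrow> ('a \<Rightarrow> 'b::real_normed_vector) \<Rightarrow> bool" where
  "smooth_on S f \<longleftrightarrow> (\<forall>n. Ck_on n S f)"

text \<open>The usual slice-chart definition: near each of its points, \<open>M\<close> is carried by an ambient
  diffeomorphism to an open piece of a \<open>d\<close>-dimensional linear subspace.\<close>

definition smooth_submanifold :: "nat \<Rightarrow> 'a::euclidean_space set \<Rightarrow> bool" where
  "smooth_submanifold d M \<longleftrightarrow>
     (\<forall>p\<in>M. \<exists>(U::'a set) (V::'a set) (W::'a set) \<Phi> \<Psi>. open U \<and> p \<in> U \<and> open V \<and> subspace W \<and> dim W = d \<and>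
        \<Phi> ` U = V \<and> \<Psi> ` V = U \<and> (\<forall>x\<in>U. \<Psi> (\<Phi> x) = x) \<and> (\<forall>y\<in>V. \<Phi> (\<Psi> y) = y) \<and>
        smooth_on U \<Phi> \<and> smooth_on V \<Psi> \<and> \<Phi> ` (M \<inter> U) = V \<inter> W)"

definition smooth_map_on :: "'a::euclidean_space set \<Rightarrow> ('a \<Rightarrow> 'b::real_normed_vector) \<Rightarrow> bool" where
  "smooth_map_on M f \<longleftrightarrow>
     (\<forall>p\<in>M. \<exists>U h. open U \<and> p \<in> U \<and> smooth_on U h \<and> (\<forall>q\<in>M \<inter> U. h q = f q))"

definition curve_germ :: "'a::euclidean_space set \<Rightarrow> 'a \<Rightarrow> 'a \<Rightarrow> (real \<Rightarrow> 'a) \<Rightarrow> bool" where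
  "curve_germ M p v c \<longleftrightarrow>
     (\<exists>e>0. smooth_on {-e<..<e} c \<and> (\<forall>t\<in>{-e<..<e}. c t \<in> M)) \<and>
     c 0 = p \<and> (c has_vector_derivative v) (at 0)"

definition tangent_space :: "'a::euclidean_space set \<Rightarrow> 'a \<Rightarrow> 'a set" where
  "tangent_space M p = {v. \<exists>c. curve_germ M p v c}"

text \<open>The derivative \<open>v(f)\<close> of a vector- or real-valued function \<open>f\<close> on \<open>M\<close> in the direction of a
  tangent vector \<open>v\<close> at \<open>p\<close>; meaningful when \<open>f\<close> is smooth on \<open>M\<close> near \<open>p\<close>.\<close>

definition tderiv ::
  "'a::euclidean_space set \<Rightarrow> ('a \<Rightarrow> 'b::real_normed_vector) \<Rightarrow> 'a \<Rightarrow> 'a \<Rightarrow> 'b" where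
  "tderiv M f p v =
     (THE w. \<forall>c. curve_germ M p v c \<longrightarrow> ((\<lambda>t. f (c t)) has_vector_derivative w) (at 0))"

definition vector_field :: "'a::euclidean_space set \<Rightarrow> ('a \<Rightarrow> 'a) \<Rightarrow> bool" where
  "vector_field M X \<longleftrightarrow> smooth_map_on M X \<and> (\<forall>p\<in>M. X p \<in> tangent_space M p)"

text \<open>Tangent vectors of \<open>M\<close> are vectors of the ambient space, so the bracket is given by the usual
  coordinate formula there.\<close>

definition lie_bracket ::
  "'a::euclidean_space set \<Rightarrow> ('a \<Rightarrow> 'a) \<Rightarrow> ('a \<Rightarrow> 'a) \<Rightarrow> 'a \<Rightarrow> 'a" where
  "lie_bracket M X Y p = tderiv M Y p (X p) - tderiv M X p (Y p)"

text \<open>The Riemannian metrics below are restrictions to the tangent spaces of one fixed bilinear form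
  \<open>g\<close> on the ambient space, hence \<open>g\<close> carries no base point.

  \<open>nabla p v Y\<close> is the covariant derivative at \<open>p\<close> of the vector field \<open>Y\<close>, defined on some
  neighbourhood \<open>M \<inter> V\<close> of \<open>p\<close> in \<open>M\<close>, in the direction of the tangent vector \<open>v\<close>.\<close>

definition affine_connection ::
  "'a::euclidean_space set \<Rightarrow> ('a \<Rightarrow> 'a \<Rightarrow> ('a \<Rightarrow> 'a) \<Rightarrow> 'a) \<Rightarrow> bool" where
  "affine_connection M nabla \<longleftrightarrow>
     (\<forall>V Y. open V \<longrightarrow> vector_field (M \<inter> V) Y \<longrightarrow>
        (\<forall>p\<in>M \<inter> V.
           (\<forall>v\<in>tangent_space M p. nabla p v Y \<in> tangent_space M p) \<and>
           (\<forall>v\<in>tangent_space M p. \<forall>w\<in>tangent_space M p. \<forall>a b.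
              nabla p (a *\<^sub>R v + b *\<^sub>R w) Y = a *\<^sub>R nabla p v Y + b *\<^sub>R nabla p w Y) \<and>
           (\<forall>v\<in>tangent_space M p. \<forall>Z. vector_field (M \<inter> V) Z \<longrightarrow>
              nabla p v (\<lambda>q. Y q + Z q) = nabla p v Y + nabla p v Z) \<and>
           (\<forall>v\<in>tangent_space M p. \<forall>f::'a \<Rightarrow> real. smooth_map_on (M \<inter> V) f \<longrightarrow>
              nabla p v (\<lambda>q. f q *\<^sub>R Y q) = tderiv M f p v *\<^sub>R Y p + f p *\<^sub>R nabla p v Y) \<and>
           (\<forall>v\<in>tangent_space M p. \<forall>Z. (\<forall>q\<in>M \<inter> V. Z q = Y q) \<longrightarrow>
              nabla p v Z = nabla p v Y)) \<and>
        (\<forall>X. vector_field (M \<inter> V) X \<longrightarrow> smooth_map_on (M \<inter> V) (\<lambda>q. nabla q (X q) Y)))"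

definition levi_civita ::
  "'a::euclidean_space set \<Rightarrow> ('a \<Rightarrow> 'a \<Rightarrow> real) \<Rightarrow> ('a \<Rightarrow> 'a \<Rightarrow> ('a \<Rightarrow> 'a) \<Rightarrow> 'a) \<Rightarrow> bool" where
  "levi_civita M g nabla \<longleftrightarrow>
     affine_connection M nabla \<and>
     (\<forall>V Y Z. open V \<longrightarrow> vector_field (M \<inter> V) Y \<longrightarrow> vector_field (M \<inter> V) Z \<longrightarrow>
        (\<forall>p\<in>M \<inter> V.
           nabla p (Y p) Z - nabla p (Z p) Y = lie_bracket M Y Z p \<and>
           (\<forall>v\<in>tangent_space M p.
              tderiv M (\<lambda>q. g (Y q) (Z q)) p v = g (nabla p v Y) (Z p) + g (Y p) (nabla p v Z))))"

definition lie_derivative_metric ::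
  "'a::euclidean_space set \<Rightarrow> ('a \<Rightarrow> 'a \<Rightarrow> real) \<Rightarrow> ('a \<Rightarrow> 'a) \<Rightarrow> ('a \<Rightarrow> 'a) \<Rightarrow> ('a \<Rightarrow> 'a) \<Rightarrow> 'a \<Rightarrow> real"
where
  "lie_derivative_metric M g Z X Y p =
     tderiv M (\<lambda>q. g (X q) (Y q)) p (Z p)
       - g (lie_bracket M Z X p) (Y p) - g (X p) (lie_bracket M Z Y p)"


section \<open>Complex projective space and the complex quadric\<close>

text \<open>A point \<open>[z]\<close> of complex projective space is represented by the orthogonal projection
  \<open>z z\<^sup>* / |z|\<^sup>2\<close> onto the line spanned by \<open>z\<close>, which realises \<open>\<complex>P\<close> as an embedded submanifold of a
  space of matrices. The lemmas below check that two vectors give the same point iff they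
  are proportional, and that the tensors \<open>complex_structure\<close> and \<open>fubini_study\<close> are, in homogeneous
  coordinates, multiplication by \<open>\<i>\<close> and
  \<open>Re (\<langle>v,w\<rangle> / |z|\<^sup>2 - \<langle>v,z\<rangle> \<langle>z,w\<rangle> / |z|\<^sup>4)\<close>. This is the Fubini-Study metric for which the Hopf map
  from the unit sphere is a Riemannian submersion.\<close>

definition hprod :: "complex^'n \<Rightarrow> complex^'n \<Rightarrow> complex" where
  "hprod v w = (\<Sum>i\<in>UNIV. v $ i * cnj (w $ i))"

definition outer :: "complex^'n \<Rightarrow> complex^'n \<Rightarrow> complex^'n^'n" where
  "outer v w = (\<chi> i j. v $ i * cnj (w $ j))"

definition cproj :: "complex^'n \<Rightarrow> complex^'n^'n" where
  "cproj z = (1 / (norm z)\<^sup>2) *\<^sub>R outer z z"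

definition quadric :: "(complex^'n^'n) set" where
  "quadric = {cproj z | z. z \<noteq> 0 \<and> (\<Sum>i\<in>UNIV. (z $ i)\<^sup>2) = 0}"

definition fubini_study :: "complex^'n^'n \<Rightarrow> complex^'n^'n \<Rightarrow> real" where
  "fubini_study X Y = (X \<bullet> Y) / 2"

definition complex_structure :: "complex^'n^'n \<Rightarrow> complex^'n^'n \<Rightarrow> complex^'n^'n" where
  "complex_structure p X = (\<chi> i j. \<i> * (X ** p - p ** X) $ i $ j)"

definition dcproj :: "complex^'n \<Rightarrow> complex^'n \<Rightarrow> complex^'n^'n" where
  "dcproj z v = (1 / (norm z)\<^sup>2) *\<^sub>R (outer v z + outer z v)
                 - (2 * (z \<bullet> v) / (norm z)^4) *\<^sub>R outer z z"

lemma complex_scaleR: "x *\<^sub>R (c::complex) = of_real x * c"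
  by (rule scaleR_conv_of_real)

lemma hprod_self: "hprod z z = of_real ((norm z)\<^sup>2)"
proof -
  have "hprod z z = (\<Sum>i\<in>UNIV. of_real ((norm (z $ i))\<^sup>2))"
    unfolding hprod_def by (intro sum.cong refl) (simp add: complex_norm_square del: of_real_power)
  also have "\<dots> = of_real ((norm z)\<^sup>2)"
    by (simp add: norm_vec_def L2_set_def sum_nonneg)
  finally show ?thesis .
qed

lemma Re_hprod: "Re (hprod v w) = v \<bullet> w"
  by (simp add: hprod_def inner_vec_def inner_complex_def)

lemma cnj_hprod: "cnj (hprod v w) = hprod w v"
  by (simp add: hprod_def mult.commute)

lemma inner_outer: "outer a b \<bullet> outer c d = Re (hprod a c * hprod d b)"
proof -
  have "hprod a c * hprod d b =
      (\<Sum>i\<in>UNIV. \<Sum>j\<in>UNIV. (a $ i * cnj (c $ i)) * (d $ j * cnj (b $ j)))"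
    by (simp add: hprod_def sum_product)
  moreover have "(a $ i * cnj (b $ j)) \<bullet> (c $ i * cnj (d $ j)) =
      Re ((a $ i * cnj (c $ i)) * (d $ j * cnj (b $ j)))" for i j
    by (simp add: inner_complex_def algebra_simps)
  ultimately show ?thesis
    by (simp add: outer_def inner_vec_def)
qed

lemma bounded_bilinear_outer: "bounded_bilinear outer"
proof (rule bilinear_conv_bounded_bilinear[THEN iffD1])
  show "bilinear (outer :: complex^'n \<Rightarrow> complex^'n \<Rightarrow> complex^'n^'n)"
    unfolding bilinear_def
    by (auto intro!: linearI simp: outer_def vec_eq_iff algebra_simps complex_scaleR)
qed

lemma has_derivative_cproj:
  assumes "z \<noteq> 0"
  shows "(cproj has_derivative dcproj z) (at z)"
proof -
  have eq: "cproj = (\<lambda>z::complex^'n. inverse (z \<bullet> z) *\<^sub>R outer z z)"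
    by (auto simp: cproj_def power2_norm_eq_inner divide_inverse)
  have nz: "z \<bullet> z \<noteq> 0" using assms by simp
  have n4: "(norm z)^4 = (z \<bullet> z) * (z \<bullet> z)"
    by (simp add: power4_eq_xxxx dot_square_norm power2_eq_square)
  show ?thesis
    unfolding eq
    by (rule derivative_eq_intros bounded_bilinear.FDERIV[OF bounded_bilinear_outer] refl nz)+
      (simp add: dcproj_def fun_eq_iff power2_norm_eq_inner n4 divide_inverse
          inner_commute algebra_simps)
qed

lemma mult_outer: "(outer a b ** outer c d) $ i $ j = hprod c b * outer a d $ i $ j"
  by (simp add: matrix_matrix_mult_def outer_def hprod_def sum_distrib_left sum_distrib_right mult_ac)

lemma cproj_eq_iff:
  assumes "z \<noteq> 0" "w \<noteq> 0"
  shows "cproj z = cproj w \<longleftrightarrow> (\<exists>c. w = c *s z)"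
proof
  assume eq: "cproj z = cproj w"
  have app: "cproj u *v x = (hprod x u / (norm u)\<^sup>2) *s u" for u x :: "complex^'n"
    by (simp add: vec_eq_iff cproj_def outer_def matrix_vector_mult_def hprod_def sum_distrib_left
        sum_distrib_right sum_divide_distrib complex_scaleR mult_ac)
  have "cproj w *v w = w"
    using assms by (simp add: app hprod_self)
  then have "w = (hprod w z / (norm z)\<^sup>2) *s z"
    using app[of z w] eq by simp
  then show "\<exists>c. w = c *s z" ..
next
  assume "\<exists>c. w = c *s z"
  then obtain c where c: "w = c *s z" ..
  have "complex_of_real ((norm w)\<^sup>2) = c * cnj c * of_real ((norm z)\<^sup>2)"
    unfolding hprod_self[symmetric] c by (simp add: hprod_def sum_distrib_left mult_ac)
  then have n: "(norm w)\<^sup>2 = (norm c)\<^sup>2 * (norm z)\<^sup>2"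
    by (metis complex_norm_square of_real_eq_iff of_real_mult)
  have "c \<noteq> 0" using assms(2) c by auto
  have "outer w w = (norm c)\<^sup>2 *\<^sub>R outer z z"
    by (simp add: c outer_def vec_eq_iff complex_scaleR complex_norm_square mult_ac
        del: of_real_power)
  then show "cproj z = cproj w"
    using \<open>c \<noteq> 0\<close> by (simp add: cproj_def n)
qed

lemma complex_structure_cproj:
  assumes "z \<noteq> 0"
  shows "complex_structure (cproj z) (dcproj z v) = dcproj z (\<i> *s v)"
proof -
  define a where "a = inverse ((norm z)\<^sup>2)"
  define h where "h = hprod v z"
  have a: "a * (norm z)\<^sup>2 = 1" using assms by (simp add: a_def)
  have ca: "of_real a * of_real ((norm z)\<^sup>2) = (1::complex)"
    using a by (metis of_real_1 of_real_mult)
  have p: "cproj z = a *\<^sub>R outer z z"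
    by (simp add: cproj_def a_def divide_inverse)
  have d: "dcproj z u = a *\<^sub>R (outer u z + outer z u) - (2 * Re (hprod u z) * a\<^sup>2) *\<^sub>R outer z z" for u
    by (simp add: dcproj_def a_def divide_inverse Re_hprod inner_commute power_inverse
        flip: power_mult)
  have h': "hprod z v = cnj h" by (simp add: h_def cnj_hprod)
  have ih: "Re (hprod (\<i> *s v) z) = - Im h"
    by (simp add: h_def hprod_def Im_sum Re_sum flip: sum_negf)
  have lin: "((a *\<^sub>R (A + B) - s *\<^sub>R C) ** (a *\<^sub>R C)) $ i $ j =
      a\<^sup>2 *\<^sub>R ((A ** C) $ i $ j + (B ** C) $ i $ j) - (s * a) *\<^sub>R (C ** C) $ i $ j"
    "((a *\<^sub>R C) ** (a *\<^sub>R (A + B) - s *\<^sub>R C)) $ i $ j =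
      a\<^sup>2 *\<^sub>R ((C ** A) $ i $ j + (C ** B) $ i $ j) - (s * a) *\<^sub>R (C ** C) $ i $ j"
    for A B C :: "complex^'n^'n" and s i j
    by (simp_all add: matrix_matrix_mult_def complex_scaleR algebra_simps power2_eq_square
        sum.distrib sum_subtractf sum_distrib_left)
  have im: "\<i> * (cnj h - h) = of_real (2 * Im h)"
    by (simp add: complex_eq_iff)
  have "complex_structure (cproj z) (dcproj z v) $ i $ j = dcproj z (\<i> *s v) $ i $ j" for i j
  proof -
    have "complex_structure (cproj z) (dcproj z v) $ i $ j =
        (of_real a * of_real ((norm z)\<^sup>2)) * (of_real a * (\<i> * (outer v z $ i $ j - outer z v $ i $ j)))
        + of_real (a\<^sup>2) * (\<i> * (cnj h - h)) * outer z z $ i $ j"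
      unfolding complex_structure_def p d
      by (simp add: lin mult_outer hprod_self h' flip: h_def)
        (simp add: complex_scaleR algebra_simps power2_eq_square)
    also have "\<dots> = dcproj z (\<i> *s v) $ i $ j"
      unfolding ca im d ih
      by (simp add: outer_def complex_scaleR algebra_simps power2_eq_square)
    finally show ?thesis .
  qed
  then show ?thesis by (simp add: vec_eq_iff)
qed

lemma fubini_study_dcproj:
  assumes "z \<noteq> 0"
  shows "fubini_study (dcproj z v) (dcproj z w) =
    Re (hprod v w / (norm z)\<^sup>2 - hprod v z * hprod z w / (norm z)^4)"
proof -
  define a where "a = inverse ((norm z)\<^sup>2)"
  have a: "a * (norm z)\<^sup>2 = 1" using assms by (simp add: a_def)
  define N where "N = (norm z)\<^sup>2"
  have aN: "a * N = 1" using a N_def by simp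
  have d: "dcproj z u = a *\<^sub>R (outer u z + outer z u) - (2 * Re (hprod u z) * a\<^sup>2) *\<^sub>R outer z z" for u
    by (simp add: dcproj_def a_def divide_inverse Re_hprod inner_commute power_inverse
        flip: power_mult)
  define p q r where "p = hprod v z" "q = hprod w z" "r = hprod v w"
  have s: "hprod z v = cnj p" "hprod z w = cnj q" "hprod w v = cnj r" "hprod v z = p"
    "hprod w z = q" "hprod v w = r" "hprod z z = of_real N"
    by (simp_all add: p_q_r_def cnj_hprod hprod_self N_def)
  have "dcproj z v \<bullet> dcproj z w = 2 * (a * (a * N)) * Re r + 2 * a\<^sup>2 * Re (cnj p * cnj q)
     - 8 * a\<^sup>2 * (a * N) * Re p * Re q + 4 * a\<^sup>2 * (a * N)\<^sup>2 * Re p * Re q"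
    unfolding d
    by (simp add: inner_diff_left inner_diff_right inner_add_left inner_add_right inner_outer s)
      (simp add: algebra_simps power2_eq_square)
  then have "dcproj z v \<bullet> dcproj z w = 2 * a * Re r - 2 * a\<^sup>2 * Re (p * cnj q)"
    unfolding aN by (simp add: algebra_simps)
  then have "fubini_study (dcproj z v) (dcproj z w) = a * Re r - a\<^sup>2 * Re (p * cnj q)"
    by (simp add: fubini_study_def)
  also have "\<dots> = Re (of_real a * r - of_real (a\<^sup>2) * (p * cnj q))"
    by (simp add: complex_eq_iff algebra_simps)
  also have "\<dots> = Re (hprod v w / (norm z)\<^sup>2 - hprod v z * hprod z w / (norm z)^4)"
    by (simp add: s a_def divide_inverse power_inverse mult_ac flip: power_mult)
  finally show ?thesis .
qed


section \<open>Real hypersurfaces of the quadric\<close>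

text \<open>In this section \<open>M\<close> is a real hypersurface of \<open>quadric\<close> with a unit normal vector field \<open>N\<close>
  defined on all of \<open>M\<close>, and \<open>nabla\<close> is the Levi-Civita connection of \<open>quadric\<close>. A hypersurface
  with only local unit normal fields is treated by passing to the pieces \<open>M \<inter> V\<close>, \<open>V\<close> open.\<close>

definition unit_normal_field :: "(complex^'n^'n) set \<Rightarrow> (complex^'n^'n \<Rightarrow> complex^'n^'n) \<Rightarrow> bool" where
  "unit_normal_field M N \<longleftrightarrow>
     smooth_map_on M N \<and>
     (\<forall>p\<in>M. N p \<in> tangent_space quadric p \<and> fubini_study (N p) (N p) = 1 \<and>
        (\<forall>X\<in>tangent_space M p. fubini_study (N p) X = 0))"

text \<open>\<open>S X = -\<nabla>\<^sub>X N\<close>. As \<open>N\<close> is only given along \<open>M\<close>, it has to be extended to a vector field of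
  the quadric near \<open>p\<close>; the result does not depend on the extension.\<close>

definition shape ::
  "(complex^'n^'n \<Rightarrow> complex^'n^'n \<Rightarrow> (complex^'n^'n \<Rightarrow> complex^'n^'n) \<Rightarrow> complex^'n^'n) \<Rightarrow>
   (complex^'n^'n) set \<Rightarrow> (complex^'n^'n \<Rightarrow> complex^'n^'n) \<Rightarrow>
   complex^'n^'n \<Rightarrow> complex^'n^'n \<Rightarrow> complex^'n^'n" where
  "shape nabla M N p X =
     - nabla p X (SOME N'. \<exists>V. open V \<and> p \<in> V \<and> vector_field (quadric \<inter> V) N' \<and>
                              (\<forall>q\<in>M \<inter> V. N' q = N q))"

definition reeb :: "(complex^'n^'n \<Rightarrow> complex^'n^'n) \<Rightarrow> complex^'n^'n \<Rightarrow> complex^'n^'n" where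
  "reeb N p = - complex_structure p (N p)"

definition eta ::
  "(complex^'n^'n \<Rightarrow> complex^'n^'n) \<Rightarrow> complex^'n^'n \<Rightarrow> complex^'n^'n \<Rightarrow> real" where
  "eta N p X = fubini_study X (reeb N p)"

definition phi ::
  "(complex^'n^'n \<Rightarrow> complex^'n^'n) \<Rightarrow> complex^'n^'n \<Rightarrow> complex^'n^'n \<Rightarrow> complex^'n^'n" where
  "phi N p X = complex_structure p X - eta N p X *\<^sub>R N p"

definition cho_operator ::
  "real \<Rightarrow> (complex^'n^'n \<Rightarrow> complex^'n^'n \<Rightarrow> (complex^'n^'n \<Rightarrow> complex^'n^'n) \<Rightarrow> complex^'n^'n) \<Rightarrow>
   (complex^'n^'n) set \<Rightarrow> (complex^'n^'n \<Rightarrow> complex^'n^'n) \<Rightarrow>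
   complex^'n^'n \<Rightarrow> complex^'n^'n \<Rightarrow> complex^'n^'n \<Rightarrow> complex^'n^'n" where
  "cho_operator k nabla M N p X Y =
     fubini_study (phi N p (shape nabla M N p X)) Y *\<^sub>R reeb N p
       - eta N p Y *\<^sub>R phi N p (shape nabla M N p X)
       - (k * eta N p X) *\<^sub>R phi N p Y"

definition torsion_operator ::
  "real \<Rightarrow> (complex^'n^'n \<Rightarrow> complex^'n^'n \<Rightarrow> (complex^'n^'n \<Rightarrow> complex^'n^'n) \<Rightarrow> complex^'n^'n) \<Rightarrow>
   (complex^'n^'n) set \<Rightarrow> (complex^'n^'n \<Rightarrow> complex^'n^'n) \<Rightarrow>
   complex^'n^'n \<Rightarrow> complex^'n^'n \<Rightarrow> complex^'n^'n \<Rightarrow> complex^'n^'n" where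
  "torsion_operator k nabla M N p X Y =
     cho_operator k nabla M N p X Y - cho_operator k nabla M N p Y X"

text \<open>The tangent vector \<open>L\<^sub>\<xi> x\<close> with \<open>g(L\<^sub>\<xi> X, Y) = (\<L>\<^sub>\<xi> g)(X, Y)\<close>; the Lie derivative is evaluated
  on local vector fields \<open>X\<close>, \<open>Y\<close> of \<open>M\<close> with \<open>X p = x\<close>.\<close>

definition structure_lie_operator ::
  "(complex^'n^'n) set \<Rightarrow> (complex^'n^'n \<Rightarrow> complex^'n^'n) \<Rightarrow>
   complex^'n^'n \<Rightarrow> complex^'n^'n \<Rightarrow> complex^'n^'n" where
  "structure_lie_operator M N p x =
     (THE u. u \<in> tangent_space M p \<and>
        (\<forall>V X Y. open V \<longrightarrow> p \<in> V \<longrightarrow>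
           vector_field (M \<inter> V) X \<longrightarrow> vector_field (M \<inter> V) Y \<longrightarrow> X p = x \<longrightarrow>
           fubini_study u (Y p) = lie_derivative_metric M fubini_study (reeb N) X Y p))"

definition lie_torsion_tensor ::
  "real \<Rightarrow> (complex^'n^'n \<Rightarrow> complex^'n^'n \<Rightarrow> (complex^'n^'n \<Rightarrow> complex^'n^'n) \<Rightarrow> complex^'n^'n) \<Rightarrow>
   (complex^'n^'n) set \<Rightarrow> (complex^'n^'n \<Rightarrow> complex^'n^'n) \<Rightarrow>
   complex^'n^'n \<Rightarrow> complex^'n^'n \<Rightarrow> complex^'n^'n \<Rightarrow> complex^'n^'n" where
  "lie_torsion_tensor k nabla M N p X Y =
     torsion_operator k nabla M N p X (structure_lie_operator M N p Y)
       - structure_lie_operator M N p (torsion_operator k nabla M N p X Y)"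

text \<open>Replacing \<open>N\<close> by \<open>-N\<close> replaces \<open>\<xi>\<close> and \<open>S\<close> by their negatives, so being Hopf does not depend on
  the choice of the local unit normal fields.\<close>

definition hopf ::
  "(complex^'n^'n \<Rightarrow> complex^'n^'n \<Rightarrow> (complex^'n^'n \<Rightarrow> complex^'n^'n) \<Rightarrow> complex^'n^'n) \<Rightarrow>
   (complex^'n^'n) set \<Rightarrow> bool" where
  "hopf nabla M \<longleftrightarrow>
     (\<forall>p\<in>M. \<exists>V N. open V \<and> p \<in> V \<and> unit_normal_field (M \<inter> V) N \<and>
        (\<exists>\<alpha>::complex^'n^'n \<Rightarrow> real. \<forall>q\<in>M \<inter> V.
           shape nabla (M \<inter> V) N q (reeb N q) = \<alpha> q *\<^sub>R reeb N q))"

end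

theory Submission
  imports Defs
begin

text \<open>Put \<open>X = \<xi>\<close> in the hypothesis. Since \<open>T\<^sub>\<xi> \<xi> = 0\<close>, it reads \<open>T\<^sub>\<xi> (L\<^sub>\<xi> \<xi>) = 0\<close>, and the \<open>\<xi>\<close>-component
  of \<open>T\<^sub>\<xi> Y\<close> is \<open>g(\<phi> S \<xi>, Y)\<close> for tangent \<open>Y\<close>. As \<open>L\<^sub>\<xi> \<xi> = \<phi> S \<xi>\<close>, this gives \<open>|\<phi> S \<xi>|\<^sup>2 = 0\<close>, hence
  \<open>S \<xi> = \<eta>(S \<xi>) \<xi>\<close>. The identity \<open>L\<^sub>\<xi> \<xi> = \<phi> S \<xi>\<close> follows from ambient derivatives: the metric is the
  restriction of a constant inner product, so \<open>\<nabla>\<close> is the tangential part of the ambient derivative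
  (Koszul formula), and \<open>\<nabla>J = 0\<close>. Local extensions of tangent vectors and of \<open>N\<close> are
  obtained from a projection onto the tangent spaces of the quadric which is polynomial in the
  base point.\<close>

section \<open>Smooth maps and tangential derivatives\<close>

text \<open>In the \<open>\<xi>\<close>-component of \<open>T_\<xi> Y\<close> the two contributions
  of \<open>\<phi> S Y\<close> from \<open>F_Y \<xi>\<close> cancel, and every term containing
  \<open>k\<close> is a multiple of some \<open>\<phi> Z\<close>, which is orthogonal to
  \<open>\<xi>\<close>; only one term is left. The obstacle is the form of the notions:
  \<open>tderiv\<close> and \<open>structure_lie_operator\<close> are definite descriptions and
  \<open>shape\<close> picks an extension by choice, so each value has to be identified by a witness
  and a uniqueness argument. Uniqueness for \<open>structure_lie_operator\<close> needs enough
  vector fields on the hypersurface, and these come from a dimension count: its tangent spaces have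
  dimension \<open>2 * m - 1\<close>, those of the quadric at most \<open>2 * m\<close>, so a
  tangent vector of the quadric that is orthogonal to the normal is tangent to the
  hypersurface.\<close>

lemma Ck_on_cong:
  assumes "open S" "\<And>x. x \<in> S \<Longrightarrow> f x = g x" "Ck_on n S f"
  shows "Ck_on n S g"
  using assms(2,3)
proof (induction n arbitrary: f g)
  case 0
  then show ?case by (simp cong: continuous_on_cong)
next
  case (Suc n)
  have d: "(g has_derivative frechet_derivative f (at x)) (at x)" if "x \<in> S" for x
  proof (rule has_derivative_transform_within_open[OF _ assms(1) that])
    show "(f has_derivative frechet_derivative f (at x)) (at x)"
      using Suc.prems(2) that assms(1)
      by (simp add: differentiable_on_eq_differentiable_at flip: frechet_derivative_works)
  qed (use Suc.prems in auto)
  then have "g differentiable_on S"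
    by (meson differentiableI differentiable_at_imp_differentiable_on)
  moreover have "Ck_on n S (\<lambda>x. frechet_derivative g (at x) v)" for v
    by (rule Suc.IH[of "\<lambda>x. frechet_derivative f (at x) v"])
      (use Suc.prems(2) frechet_derivative_at[OF d] in auto)
  ultimately show ?case by simp
qed

text \<open>Derivatives are unique on an open set, so any explicitly given \<open>f'\<close> may
  replace \<open>frechet_derivative\<close>. The closure properties below can then name their
  derivatives by the usual rules.\<close>

lemma Ck_on_SucI:
  assumes "open S" "\<And>x. x \<in> S \<Longrightarrow> (f has_derivative f' x) (at x)"
    and "\<And>v. Ck_on n S (\<lambda>x. f' x v)"
  shows "Ck_on (Suc n) S f"
proof -
  have "f differentiable_on S"
    by (meson assms(2) differentiableI differentiable_at_imp_differentiable_on)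
  moreover have "Ck_on n S (\<lambda>x. frechet_derivative f (at x) v)" for v
    by (rule Ck_on_cong[OF assms(1) _ assms(3)]) (use assms(2) frechet_derivative_at in fastforce)
  ultimately show ?thesis by simp
qed

lemma Ck_on_SucD:
  assumes "open S" "Ck_on (Suc n) S f"
  shows "x \<in> S \<Longrightarrow> (f has_derivative frechet_derivative f (at x)) (at x)"
    and "Ck_on n S (\<lambda>x. frechet_derivative f (at x) v)"
  using assms
  by (simp_all add: differentiable_on_eq_differentiable_at flip: frechet_derivative_works)

lemma Ck_on_Suc_imp: "Ck_on (Suc n) S f \<Longrightarrow> Ck_on n S f"
  by (induction n arbitrary: f) (auto intro: differentiable_imp_continuous_on)

lemma Ck_on_subset: "Ck_on n S f \<Longrightarrow> T \<subseteq> S \<Longrightarrow> Ck_on n T f"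
  by (induction n arbitrary: f) (auto intro: continuous_on_subset differentiable_on_subset)

lemma Ck_on_const: "open S \<Longrightarrow> Ck_on n S (\<lambda>x. c)"
  by (induction n arbitrary: c) (auto intro: Ck_on_SucI[of S _ "\<lambda>x v. 0"] simp del: Ck_on.simps(2))

lemma Ck_on_bounded_linear:
  assumes "bounded_linear L" "open S"
  shows "Ck_on n S L"
proof (cases n)
  case 0
  then show ?thesis using assms by (simp add: linear_continuous_on)
next
  case (Suc k)
  show ?thesis unfolding Suc
    by (rule Ck_on_SucI[of S _ "\<lambda>x. L"])
      (use assms in \<open>auto intro: bounded_linear_imp_has_derivative Ck_on_const\<close>)
qed

lemma Ck_on_compose_linear:
  assumes "bounded_linear L" "open S" "Ck_on n S f"
  shows "Ck_on n S (\<lambda>x. L (f x))"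
  using assms(3)
proof (induction n arbitrary: f)
  case 0
  then show ?case using assms(1) by (auto intro: bounded_linear.continuous_on)
next
  case (Suc n)
  show ?case
    by (rule Ck_on_SucI[OF assms(2)]) (auto intro: bounded_linear.has_derivative[OF assms(1)]
      Ck_on_SucD[OF assms(2) Suc.prems] Suc.IH)
qed

lemma Ck_on_add:
  assumes "open S" "Ck_on n S f" "Ck_on n S g"
  shows "Ck_on n S (\<lambda>x. f x + g x)"
  using assms(2,3)
proof (induction n arbitrary: f g)
  case 0
  then show ?case by (auto intro: continuous_on_add)
next
  case (Suc n)
  show ?case
    by (rule Ck_on_SucI[OF assms(1)]) (auto intro!: has_derivative_add
      Ck_on_SucD[OF assms(1) Suc.prems(1)] Ck_on_SucD[OF assms(1) Suc.prems(2)] Suc.IH)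
qed

lemma Ck_on_bilinear:
  assumes "bounded_bilinear B" "open S" "Ck_on n S f" "Ck_on n S g"
  shows "Ck_on n S (\<lambda>x. B (f x) (g x))"
  using assms(3,4)
proof (induction n arbitrary: f g)
  case 0
  then show ?case using assms(1) by (auto intro: bounded_bilinear.continuous_on)
next
  case (Suc n)
  show ?case
    \<comment> \<open>The product rule keeps one undifferentiated factor in each summand; lowering
      its class by one makes the induction hypothesis applicable.\<close>
    by (rule Ck_on_SucI[OF assms(2)]) (auto intro!: bounded_bilinear.FDERIV[OF assms(1)] Ck_on_add
      Ck_on_SucD[OF assms(2) Suc.prems(1)] Ck_on_SucD[OF assms(2) Suc.prems(2)] Suc.IH
      Suc.prems[THEN Ck_on_Suc_imp] assms(2))
qed

text \<open>The derivative of \<open>1/f\<close> is a product of \<open>1/f\<close> twice with the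
  derivative of \<open>f\<close>, so regularity of \<open>1/f\<close> of order \<open>n\<close>
  yields order \<open>n + 1\<close>.\<close>

lemma Ck_on_inverse:
  fixes f :: "'a::euclidean_space \<Rightarrow> real"
  assumes "open S" "Ck_on n S f" "\<And>x. x \<in> S \<Longrightarrow> f x \<noteq> 0"
  shows "Ck_on n S (\<lambda>x. inverse (f x))"
  using assms(2)
proof (induction n)
  case 0
  then show ?case using assms(3) by (auto intro: continuous_on_inverse)
next
  case (Suc n)
  note mult = Ck_on_bilinear[OF bounded_bilinear_mult assms(1)]
  note IH = Suc.IH[OF Ck_on_Suc_imp[OF Suc.prems]]
  show ?case
  proof (rule Ck_on_SucI[OF assms(1)])
    show "((\<lambda>x. inverse (f x)) has_derivative
        (\<lambda>h. - (inverse (f x) * frechet_derivative f (at x) h * inverse (f x)))) (at x)" if "x \<in> S" for x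
      by (rule Deriv.has_derivative_inverse[OF assms(3)[OF that] Ck_on_SucD(1)[OF assms(1) Suc.prems that]])
    show "Ck_on n S (\<lambda>x. - (inverse (f x) * frechet_derivative f (at x) v * inverse (f x)))" for v
      by (rule Ck_on_compose_linear[OF bounded_linear_minus[OF bounded_linear_ident] assms(1)
            mult[OF mult[OF IH Ck_on_SucD(2)[OF assms(1) Suc.prems]] IH]])
  qed
qed

lemma open_line:
  fixes a w :: "'a::real_normed_vector"
  assumes "open S"
  shows "open {t::real. a + t *\<^sub>R w \<in> S}"
proof -
  have "open ((\<lambda>t::real. a + t *\<^sub>R w) -` S)"
    by (intro open_vimage assms continuous_intros)
  then show ?thesis by (simp add: vimage_def)
qed

text \<open>Along a line the derivative is the directional derivative of \<open>f\<close> in the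
  fixed direction \<open>w\<close>, again a function restricted to the same line; hence the
  induction closes. This is the form of the chain rule that curves through slice charts
  require.\<close>

lemma Ck_on_line:
  assumes "open S" "Ck_on n S f"
  shows "Ck_on n {t::real. a + t *\<^sub>R w \<in> S} (\<lambda>t. f (a + t *\<^sub>R w))"
proof -
  have op: "open {t::real. a + t *\<^sub>R w \<in> S}"
    by (rule open_line[OF assms(1)])
  show ?thesis
    using assms(2)
  proof (induction n arbitrary: f)
    case 0
    then show ?case
      by (auto intro!: continuous_on_compose2[of S f] continuous_intros)
  next
    case (Suc n)
    have lin: "linear (frechet_derivative f (at x))" if "x \<in> S" for x
      using Ck_on_SucD(1)[OF assms(1) Suc.prems that] by (rule has_derivative_linear)
    show ?case
    proof (rule Ck_on_SucI[OF op])
      fix t assume "t \<in> {t::real. a + t *\<^sub>R w \<in> S}"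
      then have t: "a + t *\<^sub>R w \<in> S" by simp
      have "((\<lambda>t. a + t *\<^sub>R w) has_derivative (\<lambda>s. s *\<^sub>R w)) (at t)"
        by (auto intro!: derivative_eq_intros)
      from has_derivative_compose[OF this Ck_on_SucD(1)[OF assms(1) Suc.prems t]]
      show "((\<lambda>t. f (a + t *\<^sub>R w)) has_derivative
          (\<lambda>s. s *\<^sub>R frechet_derivative f (at (a + t *\<^sub>R w)) w)) (at t)"
        using linear_scale[OF lin[OF t]] by simp
    next
      fix s
      show "Ck_on n {t. a + t *\<^sub>R w \<in> S} (\<lambda>t. s *\<^sub>R frechet_derivative f (at (a + t *\<^sub>R w)) w)"
        by (rule Ck_on_compose_linear[OF bounded_linear_scaleR_right op
              Suc.IH[OF Ck_on_SucD(2)[OF assms(1) Suc.prems]]])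
    qed
  qed
qed

lemma smooth_on_subset: "smooth_on S f \<Longrightarrow> T \<subseteq> S \<Longrightarrow> smooth_on T f"
  by (auto simp: smooth_on_def intro: Ck_on_subset)

lemma smooth_on_const: "open S \<Longrightarrow> smooth_on S (\<lambda>x. c)"
  by (auto simp: smooth_on_def intro: Ck_on_const)

lemma smooth_on_bounded_linear: "bounded_linear L \<Longrightarrow> open S \<Longrightarrow> smooth_on S L"
  by (auto simp: smooth_on_def intro: Ck_on_bounded_linear)

lemma smooth_on_id: "open S \<Longrightarrow> smooth_on S (\<lambda>x. x)"
  by (rule smooth_on_bounded_linear[OF bounded_linear_ident])

lemma smooth_on_compose_linear:
  "bounded_linear L \<Longrightarrow> open S \<Longrightarrow> smooth_on S f \<Longrightarrow> smooth_on S (\<lambda>x. L (f x))"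
  by (auto simp: smooth_on_def intro: Ck_on_compose_linear)

lemma smooth_on_add:
  "open S \<Longrightarrow> smooth_on S f \<Longrightarrow> smooth_on S g \<Longrightarrow> smooth_on S (\<lambda>x. f x + g x)"
  by (auto simp: smooth_on_def intro: Ck_on_add)

lemma smooth_on_diff:
  assumes "open S" "smooth_on S f" "smooth_on S g"
  shows "smooth_on S (\<lambda>x. f x - g x)"
  using smooth_on_add[OF assms(1,2)
      smooth_on_compose_linear[OF bounded_linear_minus[OF bounded_linear_ident] assms(1,3)]]
  by simp

lemma smooth_on_bilinear:
  "bounded_bilinear B \<Longrightarrow> open S \<Longrightarrow> smooth_on S f \<Longrightarrow> smooth_on S g \<Longrightarrow> smooth_on S (\<lambda>x. B (f x) (g x))"
  by (auto simp: smooth_on_def intro: Ck_on_bilinear)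

lemma smooth_on_inverse:
  fixes f :: "'a::euclidean_space \<Rightarrow> real"
  shows "open S \<Longrightarrow> smooth_on S f \<Longrightarrow> (\<And>x. x \<in> S \<Longrightarrow> f x \<noteq> 0) \<Longrightarrow> smooth_on S (\<lambda>x. inverse (f x))"
  by (auto simp: smooth_on_def intro: Ck_on_inverse)

lemma smooth_on_has_derivative:
  assumes "open S" "smooth_on S f" "x \<in> S"
  shows "(f has_derivative frechet_derivative f (at x)) (at x)"
  using assms Ck_on_SucD(1) unfolding smooth_on_def by blast

lemma smooth_on_imp_continuous_on: "smooth_on S f \<Longrightarrow> continuous_on S f"
  unfolding smooth_on_def by (metis Ck_on.simps(1))

section \<open>Smooth maps on arbitrary subsets and their derivatives along curves\<close>

lemma smooth_map_onI:
  "(\<And>p. p \<in> M \<Longrightarrow> \<exists>U h. open U \<and> p \<in> U \<and> smooth_on U h \<and> (\<forall>q\<in>M \<inter> U. h q = f q)) \<Longrightarrow> smooth_map_on M f"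
  unfolding smooth_map_on_def by blast

lemma smooth_map_on_bilinear:
  assumes "bounded_bilinear B" "smooth_map_on M f" "smooth_map_on M g"
  shows "smooth_map_on M (\<lambda>q. B (f q) (g q))"
proof (rule smooth_map_onI)
  fix p assume "p \<in> M"
  then obtain U h U' h' where "open U" "p \<in> U" "smooth_on U h" "\<forall>q\<in>M \<inter> U. h q = f q"
    "open U'" "p \<in> U'" "smooth_on U' h'" "\<forall>q\<in>M \<inter> U'. h' q = g q"
    using assms(2,3) unfolding smooth_map_on_def by metis
  then show "\<exists>U h. open U \<and> p \<in> U \<and> smooth_on U h \<and> (\<forall>q\<in>M \<inter> U. h q = B (f q) (g q))"
    by (intro exI[of _ "U \<inter> U'"] exI[of _ "\<lambda>q. B (h q) (h' q)"])
      (auto intro!: smooth_on_bilinear[OF assms(1)] intro: smooth_on_subset)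
qed

lemma smooth_map_on_add:
  assumes "smooth_map_on M f" "smooth_map_on M g"
  shows "smooth_map_on M (\<lambda>q. f q + g q)"
proof (rule smooth_map_onI)
  fix p assume "p \<in> M"
  then obtain U h U' h' where "open U" "p \<in> U" "smooth_on U h" "\<forall>q\<in>M \<inter> U. h q = f q"
    "open U'" "p \<in> U'" "smooth_on U' h'" "\<forall>q\<in>M \<inter> U'. h' q = g q"
    using assms unfolding smooth_map_on_def by metis
  then show "\<exists>U h. open U \<and> p \<in> U \<and> smooth_on U h \<and> (\<forall>q\<in>M \<inter> U. h q = f q + g q)"
    by (intro exI[of _ "U \<inter> U'"] exI[of _ "\<lambda>q. h q + h' q"])
      (auto intro!: smooth_on_add intro: smooth_on_subset)
qed

lemma smooth_map_on_linear:
  assumes "bounded_linear L" "smooth_map_on M f"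
  shows "smooth_map_on M (\<lambda>q. L (f q))"
proof (rule smooth_map_onI)
  fix p assume "p \<in> M"
  then obtain U h where "open U" "p \<in> U" "smooth_on U h" "\<forall>q\<in>M \<inter> U. h q = f q"
    using assms unfolding smooth_map_on_def by metis
  then show "\<exists>U h. open U \<and> p \<in> U \<and> smooth_on U h \<and> (\<forall>q\<in>M \<inter> U. h q = L (f q))"
    by (intro exI[of _ U] exI[of _ "\<lambda>q. L (h q)"])
      (auto intro!: smooth_on_compose_linear[OF assms(1)])
qed

lemma smooth_map_on_const: "smooth_map_on M (\<lambda>q. c)"
  by (rule smooth_map_onI) (auto intro!: exI[of _ UNIV] exI[of _ "\<lambda>q. c"] smooth_on_const)

lemma smooth_map_on_id: "smooth_map_on M (\<lambda>q. q)"
  by (rule smooth_map_onI) (auto intro!: exI[of _ UNIV] exI[of _ "\<lambda>q. q"] smooth_on_id)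

lemma smooth_map_on_uminus: "smooth_map_on M f \<Longrightarrow> smooth_map_on M (\<lambda>q. - f q)"
  by (rule smooth_map_on_linear[OF bounded_linear_minus[OF bounded_linear_ident]])

lemma smooth_map_on_diff:
  assumes "smooth_map_on M f" "smooth_map_on M g"
  shows "smooth_map_on M (\<lambda>q. f q - g q)"
  using smooth_map_on_add[OF assms(1) smooth_map_on_uminus[OF assms(2)]] by simp

text \<open>Here \<open>D\<close> is determined by \<open>M\<close> and \<open>f\<close> on \<open>tangent_space M p\<close> only.\<close>

definition has_tderiv ::
  "'a::euclidean_space set \<Rightarrow> ('a \<Rightarrow> 'b::real_normed_vector) \<Rightarrow> 'a \<Rightarrow> ('a \<Rightarrow> 'b) \<Rightarrow> bool" where
  "has_tderiv M f p D \<longleftrightarrow>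
     (\<exists>U h. open U \<and> p \<in> U \<and> (h has_derivative D) (at p) \<and> (\<forall>q\<in>M \<inter> U. h q = f q))"

lemma smooth_map_on_has_tderiv:
  assumes "smooth_map_on (M \<inter> V) f" "open V" "p \<in> M" "p \<in> V"
  shows "\<exists>D. has_tderiv M f p D"
proof -
  obtain U h where "open U" "p \<in> U" "smooth_on U h" "\<forall>q\<in>M \<inter> V \<inter> U. h q = f q"
    using assms unfolding smooth_map_on_def by (metis IntI)
  then show ?thesis unfolding has_tderiv_def
    using smooth_on_has_derivative assms(2,4) by (metis Int_assoc IntI open_Int)
qed

lemma has_tderiv_bilinear:
  assumes "bounded_bilinear B" "has_tderiv M f p D" "has_tderiv M g p E" "p \<in> M"
  shows "has_tderiv M (\<lambda>q. B (f q) (g q)) p (\<lambda>v. B (f p) (E v) + B (D v) (g p))"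
proof -
  obtain U h U' h' where *: "open U" "p \<in> U" "(h has_derivative D) (at p)" "\<forall>q\<in>M \<inter> U. h q = f q"
    "open U'" "p \<in> U'" "(h' has_derivative E) (at p)" "\<forall>q\<in>M \<inter> U'. h' q = g q"
    using assms(2,3) unfolding has_tderiv_def by metis
  have "h p = f p" "h' p = g p" using * assms(4) by auto
  with * show ?thesis
    unfolding has_tderiv_def
    using bounded_bilinear.FDERIV[OF assms(1) *(3) *(7)]
    by (intro exI[of _ "U \<inter> U'"] exI[of _ "\<lambda>q. B (h q) (h' q)"]) auto
qed

lemma has_tderiv_linear:
  assumes "bounded_linear L" "has_tderiv M f p D"
  shows "has_tderiv M (\<lambda>q. L (f q)) p (\<lambda>v. L (D v))"
proof -
  obtain U h where "open U" "p \<in> U" "(h has_derivative D) (at p)" "\<forall>q\<in>M \<inter> U. h q = f q"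
    using assms(2) unfolding has_tderiv_def by metis
  then show ?thesis unfolding has_tderiv_def
    by (intro exI[of _ U] exI[of _ "\<lambda>q. L (h q)"]) (auto intro: bounded_linear.has_derivative[OF assms(1)])
qed

lemma has_tderiv_id: "has_tderiv M (\<lambda>q. q) p (\<lambda>v. v)"
  unfolding has_tderiv_def by (intro exI[of _ UNIV] exI[of _ "\<lambda>q. q"]) (auto intro: has_derivative_ident)

lemma has_tderiv_imp_linear: "has_tderiv M f p D \<Longrightarrow> linear D"
  unfolding has_tderiv_def by (auto dest: has_derivative_linear)

lemma has_tderiv_cong:
  assumes "has_tderiv M f p D" "open V" "p \<in> V" "\<And>q. q \<in> M \<inter> V \<Longrightarrow> g q = f q"
  shows "has_tderiv M g p D"
proof -
  obtain U h where "open U" "p \<in> U" "(h has_derivative D) (at p)" "\<forall>q\<in>M \<inter> U. h q = f q"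
    using assms(1) unfolding has_tderiv_def by metis
  then show ?thesis unfolding has_tderiv_def
    using assms(2-) by (intro exI[of _ "U \<inter> V"] exI[of _ h]) auto
qed

lemma has_tderiv_mono:
  "has_tderiv M f p D \<Longrightarrow> N \<subseteq> M \<Longrightarrow> has_tderiv N f p D"
  unfolding has_tderiv_def by blast

text \<open>For small parameters the curve stays in the open set where \<open>f\<close> agrees with
  its ambient extension, so the chain rule for the extension applies. The result depends on the
  curve only through its velocity.\<close>

lemma has_tderiv_curve:
  assumes "has_tderiv M f p D" "curve_germ M p v c"
  shows "((\<lambda>t. f (c t)) has_vector_derivative D v) (at 0)"
proof -
  obtain U h where h: "open U" "p \<in> U" "(h has_derivative D) (at p)" "\<forall>q\<in>M \<inter> U. h q = f q"
    using assms(1) unfolding has_tderiv_def by metis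
  obtain e where e: "e > 0" "smooth_on {-e<..<e} c" "\<forall>t\<in>{-e<..<e}. c t \<in> M"
    and c: "c 0 = p" "(c has_vector_derivative v) (at 0)"
    using assms(2) unfolding curve_germ_def by blast
  have op: "open (c -` U \<inter> {-e<..<e})"
    using smooth_on_imp_continuous_on[OF e(2)] h(1) continuous_on_open_vimage open_greaterThanLessThan by blast
  have mem: "0 \<in> c -` U \<inter> {-e<..<e}" using e(1) c h(2) by auto
  have "((\<lambda>t. h (c t)) has_vector_derivative D v) (at 0)"
  proof -
    have "((\<lambda>t. h (c t)) has_derivative (\<lambda>t. D (t *\<^sub>R v))) (at 0)"
      using has_derivative_compose[of c _ 0 UNIV h D] c h(3) unfolding has_vector_derivative_def by simp
    then show ?thesis
      using linear_scale[OF has_derivative_linear[OF h(3)]] by (simp add: has_vector_derivative_def)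
  qed
  then show ?thesis
    by (rule has_vector_derivative_transform_within_open[OF _ op mem]) (use e h(4) in auto)
qed

text \<open>Tangency of \<open>v\<close> provides a curve with this velocity, and one curve already
  determines the described derivative.\<close>

lemma tderiv_eq:
  assumes "has_tderiv M f p D" "v \<in> tangent_space M p"
  shows "tderiv M f p v = D v"
  unfolding tderiv_def
proof (rule the_equality)
  show "\<forall>c. curve_germ M p v c \<longrightarrow> ((\<lambda>t. f (c t)) has_vector_derivative D v) (at 0)"
    using has_tderiv_curve[OF assms(1)] by blast
  fix w assume w: "\<forall>c. curve_germ M p v c \<longrightarrow> ((\<lambda>t. f (c t)) has_vector_derivative w) (at 0)"
  obtain c where "curve_germ M p v c" using assms(2) unfolding tangent_space_def by blast
  then show "w = D v"
    using w has_tderiv_curve[OF assms(1)] vector_derivative_unique_at by blast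
qed

section \<open>Tangent spaces of embedded submanifolds\<close>

lemma tangent_space_mono:
  assumes "M \<subseteq> M'"
  shows "tangent_space M p \<subseteq> tangent_space M' p"
  using assms unfolding tangent_space_def curve_germ_def by blast

text \<open>By continuity a curve stays in \<open>V\<close> after its parameter interval is
  shortened. This is what allows hypersurfaces to be treated on the pieces where a unit normal field
  exists.\<close>

lemma tangent_space_Int_open:
  assumes "open V" "p \<in> V"
  shows "tangent_space (M \<inter> V) p = tangent_space M p"
proof
  show "tangent_space (M \<inter> V) p \<subseteq> tangent_space M p" by (rule tangent_space_mono) auto
  show "tangent_space M p \<subseteq> tangent_space (M \<inter> V) p"
  proof
    fix v assume "v \<in> tangent_space M p"
    then obtain c e where e: "e > 0" "smooth_on {-e<..<e} c" "\<forall>t\<in>{-e<..<e}. c t \<in> M"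
      and c: "c 0 = p" "(c has_vector_derivative v) (at 0)"
      unfolding tangent_space_def curve_germ_def by blast
    have "open (c -` V \<inter> {-e<..<e})"
      using smooth_on_imp_continuous_on[OF e(2)] assms(1) continuous_on_open_vimage open_greaterThanLessThan by blast
    moreover have "0 \<in> c -` V \<inter> {-e<..<e}" using e(1) c assms(2) by auto
    ultimately obtain d where d: "d > 0" "ball 0 d \<subseteq> c -` V \<inter> {-e<..<e}"
      using open_contains_ball by blast
    have sub: "{-d<..<d} \<subseteq> c -` V \<inter> {-e<..<e}" using d by (simp add: ball_eq_greaterThanLessThan)
    have "curve_germ (M \<inter> V) p v c"
      unfolding curve_germ_def
      using d(1) e(3) c sub by (auto intro!: exI[of _ d] intro: smooth_on_subset[OF e(2)])
    then show "v \<in> tangent_space (M \<inter> V) p" unfolding tangent_space_def by blast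
  qed
qed

text \<open>The slice chart straightens \<open>M\<close> to the subspace \<open>W\<close>, so the
  tangent space is the image of \<open>W\<close> under the derivative \<open>B\<close> of the
  inverse chart.\<close>

lemma tangent_space_submanifold:
  fixes M :: "'a::euclidean_space set"
  assumes "smooth_submanifold d M" "p \<in> M"
  shows "subspace (tangent_space M p)" "dim (tangent_space M p) = d"
proof -
  obtain U V :: "'a set" and W :: "'a set" and \<Phi> \<Psi> where "open U" "p \<in> U" "open V" "subspace W" "dim W = d"
     and im: "\<Phi> ` U = V" "\<Psi> ` V = U" and inv: "\<forall>x\<in>U. \<Psi> (\<Phi> x) = x" "\<forall>y\<in>V. \<Phi> (\<Psi> y) = y" and
      sm: "smooth_on U \<Phi>" "smooth_on V \<Psi>" and MW: "\<Phi> ` (M \<inter> U) = V \<inter> W"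
    using assms unfolding smooth_submanifold_def by metis
  define A where "A = frechet_derivative \<Phi> (at p)"
  define B where "B = frechet_derivative \<Psi> (at (\<Phi> p))"
  have pV: "\<Phi> p \<in> V" "\<Psi> (\<Phi> p) = p" "\<Phi> p \<in> W" using \<open>p \<in> U\<close> im inv MW assms(2) by auto
  have A: "(\<Phi> has_derivative A) (at p)" unfolding A_def
    using smooth_on_has_derivative[OF \<open>open U\<close> sm(1) \<open>p \<in> U\<close>] .
  have B: "(\<Psi> has_derivative B) (at (\<Phi> p))" unfolding B_def
    using smooth_on_has_derivative[OF \<open>open V\<close> sm(2) pV(1)] .
  have BA: "B (A v) = v" for v
  proof -
    have "((\<lambda>x. \<Psi> (\<Phi> x)) has_derivative (\<lambda>v. B (A v))) (at p)"
      using has_derivative_compose[OF A B] .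
    moreover have "((\<lambda>x. \<Psi> (\<Phi> x)) has_derivative (\<lambda>v. v)) (at p)"
      by (rule has_derivative_transform_within_open[OF has_derivative_ident \<open>open U\<close> \<open>p \<in> U\<close>]) (use inv in simp)
    ultimately show ?thesis using has_derivative_unique by metis
  qed
  have linA: "linear A" and linB: "linear B" using A B has_derivative_linear by blast+
  have "inj A" by (metis BA injI)
  then have "surj A" using linA linear_injective_imp_surjective by blast
  then have AB: "A (B w) = w" for w by (metis BA surjD)
  have "tangent_space M p = B ` W"
  proof
    show "tangent_space M p \<subseteq> B ` W"
    proof
      fix v assume "v \<in> tangent_space M p"
      then obtain c where c: "curve_germ (M \<inter> U) p v c"
        using tangent_space_Int_open[OF \<open>open U\<close> \<open>p \<in> U\<close>] unfolding tangent_space_def by blast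
      then obtain e where e: "e > 0" "\<forall>t\<in>{-e<..<e}. c t \<in> M \<inter> U" "c 0 = p"
        unfolding curve_germ_def by blast
      have "has_tderiv (M \<inter> U) \<Phi> p A" unfolding has_tderiv_def using A by blast
      from has_tderiv_curve[OF this c]
      have d: "((\<lambda>t. \<Phi> (c t)) has_vector_derivative A v) (at 0)" .
      \<comment> \<open>The velocity of a curve in \<open>W\<close> lies in \<open>W\<close>: its
        inner product with any vector orthogonal to \<open>W\<close> is the derivative of a function
        vanishing near 0. The double orthogonal complement then returns \<open>W\<close>.\<close>
      have orth: "A v \<bullet> u = 0" if "u \<in> W\<^sup>\<bottom>" for u
      proof -
        have "((\<lambda>t. \<Phi> (c t) \<bullet> u) has_vector_derivative A v \<bullet> u) (at 0)"
          using bounded_linear.has_vector_derivative[OF bounded_linear_inner_left d] .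
        moreover have "((\<lambda>t. \<Phi> (c t) \<bullet> u) has_vector_derivative 0) (at 0)"
        proof (rule has_vector_derivative_transform_within_open[OF has_vector_derivative_const])
          show "0 = \<Phi> (c t) \<bullet> u" if "t \<in> {-e<..<e}" for t
          proof -
            have "\<Phi> (c t) \<in> W" using e(2) that MW by blast
            then show ?thesis using \<open>u \<in> W\<^sup>\<bottom>\<close> by (simp add: orthogonal_comp_def orthogonal_def)
          qed
        qed (use e(1) in auto)
        ultimately show ?thesis by (rule vector_derivative_unique_at)
      qed
      have "A v \<in> W\<^sup>\<bottom>\<^sup>\<bottom>" using orth by (auto simp: orthogonal_comp_def orthogonal_def inner_commute)
      then have "A v \<in> W" using orthogonal_comp_self[OF \<open>subspace W\<close>] by simp
      then show "v \<in> B ` W" using BA by (metis image_eqI)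
    qed
    show "B ` W \<subseteq> tangent_space M p"
    proof (clarify)
      fix w assume "w \<in> W"
      \<comment> \<open>A straight segment in the slice, carried back to \<open>M\<close> by the
        inverse chart.\<close>
      define c where "c = (\<lambda>t::real. \<Psi> (\<Phi> p + t *\<^sub>R w))"
      define T where "T = {t::real. \<Phi> p + t *\<^sub>R w \<in> V}"
      have "open T"
        unfolding T_def by (rule open_line[OF \<open>open V\<close>])
      moreover have "0 \<in> T" using pV by (simp add: T_def)
      ultimately obtain e where e: "e > 0" "ball 0 e \<subseteq> T" using open_contains_ball by blast
      have sub: "{-e<..<e} \<subseteq> T" using e by (simp add: ball_eq_greaterThanLessThan)
      have "smooth_on T c" unfolding T_def c_def smooth_on_def
        using Ck_on_line[OF \<open>open V\<close>] sm(2) unfolding smooth_on_def by blast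
      moreover have "c t \<in> M" if "t \<in> T" for t
      proof -
        have "\<Phi> p + t *\<^sub>R w \<in> V \<inter> W"
          using that pV \<open>w \<in> W\<close> \<open>subspace W\<close> by (simp add: T_def subspace_add subspace_scale)
        then show ?thesis using MW inv unfolding c_def by (metis IntD1 IntD2 imageE)
      qed
      moreover have "(c has_vector_derivative B w) (at 0)"
      proof -
        have "((\<lambda>t. \<Phi> p + t *\<^sub>R w) has_derivative (\<lambda>t. t *\<^sub>R w)) (at 0)"
          by (auto intro!: derivative_eq_intros)
        from has_derivative_compose[OF this, of \<Psi> B] B
        show ?thesis by (simp add: c_def has_vector_derivative_def linear_scale[OF linB])
      qed
      ultimately have "curve_germ M p (B w) c"
        unfolding curve_germ_def using e(1) sub pV
        by (auto intro!: exI[of _ e] simp: c_def intro: smooth_on_subset)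
      then show "B w \<in> tangent_space M p" unfolding tangent_space_def by blast
    qed
  qed
  then show "subspace (tangent_space M p)" "dim (tangent_space M p) = d"
    using \<open>subspace W\<close> linB \<open>dim W = d\<close> AB
    by (auto intro: linear_subspace_image)
      (metis dim_image_eq inj_on_inverseI)
qed

section \<open>Tangent spaces of the quadric\<close>

text \<open>The complex bilinear form, in contrast to the Hermitian \<open>hprod\<close>; its null
  cone is the affine cone over the quadric.\<close>

definition cdot :: "complex^'n \<Rightarrow> complex^'n \<Rightarrow> complex" where
  "cdot v w = (\<Sum>i\<in>UNIV. v $ i * w $ i)"

definition conj_vec :: "complex^'n \<Rightarrow> complex^'n" where
  "conj_vec v = (\<chi> i. cnj (v $ i))"

definition null_vec :: "complex^'n \<Rightarrow> bool" where
  "null_vec z \<longleftrightarrow> z \<noteq> 0 \<and> cdot z z = 0"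

text \<open>Horizontal lifts to \<open>z\<close> of the tangent vectors of the quadric: the first
  condition removes the complex line of \<open>z\<close>, the second is the linearised equation of
  the null cone at \<open>z\<close>.\<close>

definition horizontal :: "complex^'n \<Rightarrow> (complex^'n) set" where
  "horizontal z = {v. hprod v z = 0 \<and> cdot v z = 0}"

lemma quadric_eq: "quadric = cproj ` {z. null_vec z}"
  by (auto simp: quadric_def null_vec_def cdot_def power2_eq_square)

lemma hprod_simps:
  "hprod (u + v) w = hprod u w + hprod v w"
  "hprod w (u + v) = hprod w u + hprod w v"
  "hprod (u - v) w = hprod u w - hprod v w"
  "hprod w (u - v) = hprod w u - hprod w v"
  "hprod (c *s v) w = c * hprod v w"
  "hprod v (c *s w) = cnj c * hprod v w"
  "hprod (r *\<^sub>R v) w = of_real r * hprod v w"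
  "hprod v (r *\<^sub>R w) = of_real r * hprod v w"
  by (simp_all add: hprod_def algebra_simps sum.distrib sum_subtractf sum_distrib_left complex_scaleR)

lemma cdot_simps:
  "cdot (u + v) w = cdot u w + cdot v w"
  "cdot w (u + v) = cdot w u + cdot w v"
  "cdot (u - v) w = cdot u w - cdot v w"
  "cdot w (u - v) = cdot w u - cdot w v"
  "cdot (c *s v) w = c * cdot v w"
  "cdot v (c *s w) = c * cdot v w"
  "cdot (r *\<^sub>R v) w = of_real r * cdot v w"
  "cdot v (r *\<^sub>R w) = of_real r * cdot v w"
  by (simp_all add: cdot_def algebra_simps sum.distrib sum_subtractf sum_distrib_left complex_scaleR)

lemma cdot_commute: "cdot v w = cdot w v"
  by (simp add: cdot_def mult.commute)

lemma cdot_conj_vec: "cdot v (conj_vec w) = hprod v w"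
  by (simp add: cdot_def hprod_def conj_vec_def)

lemma hprod_conj_vec: "hprod v (conj_vec w) = cdot v w" "hprod (conj_vec v) w = cnj (cdot v w)"
  by (simp_all add: cdot_def hprod_def conj_vec_def)

lemma outer_simps:
  "outer (u + v) w = outer u w + outer v w"
  "outer (c *s v) w $ i $ j = c * outer v w $ i $ j"
  "outer w (c *s v) $ i $ j = cnj c * outer w v $ i $ j"
  by (simp_all add: outer_def vec_eq_iff algebra_simps)

lemma outer_mult_vec: "outer u v *v x = hprod x v *s u"
  by (simp add: vec_eq_iff outer_def matrix_vector_mult_def hprod_def sum_distrib_left
      sum_distrib_right mult_ac)

lemma mult_outer_right: "A ** outer u v = outer (A *v u) v"
  by (simp add: vec_eq_iff outer_def matrix_matrix_mult_def matrix_vector_mult_def sum_distrib_left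
      sum_distrib_right mult_ac)

lemma scaleR_mult_vec: "(r *\<^sub>R A) *v x = r *\<^sub>R (A *v (x::complex^'n))"
  by (simp add: vec_eq_iff matrix_vector_mult_def scaleR_sum_right)

lemma cproj_mult_vec: "cproj z *v x = (hprod x z / (norm z)\<^sup>2) *s z"
  by (simp add: cproj_def scaleR_mult_vec outer_mult_vec vec_eq_iff complex_scaleR)

lemma transpose_cproj_mult_vec: "transpose (cproj z) *v x = (cdot x z / (norm z)\<^sup>2) *s conj_vec z"
  by (simp add: cproj_def outer_def transpose_def vec_eq_iff matrix_vector_mult_def cdot_def conj_vec_def
      complex_scaleR sum_distrib_left sum_distrib_right sum_divide_distrib mult_ac)

lemma cproj_hermitian: "cproj z $ i $ j = cnj (cproj z $ j $ i)"
  by (simp add: cproj_def outer_def complex_scaleR mult.commute)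

lemma bounded_linear_dcproj: "z \<noteq> 0 \<Longrightarrow> bounded_linear (dcproj z)"
  using has_derivative_bounded_linear has_derivative_cproj by blast

text \<open>\<open>cproj\<close> is constant on complex lines without the origin, so its derivative
  kills the directions along the line.\<close>

lemma dcproj_scale_self:
  assumes "z \<noteq> 0" shows "dcproj z (c *s z) = 0"
proof -
  define a where "a = (norm z)\<^sup>2"
  have n4: "(norm z)^4 = a * a" by (simp add: a_def flip: power_add)
  have a: "a \<noteq> 0" using assms by (simp add: a_def)
  have "z \<bullet> (c *s z) = Re c * a"
    unfolding a_def by (simp only: Re_hprod[symmetric] hprod_simps hprod_self) simp
  then have s: "2 * (z \<bullet> (c *s z)) / (norm z)^4 = 1 / a * (2 * Re c)"
    using a by (simp add: n4)
  have "outer (c *s z) z + outer z (c *s z) = (2 * Re c) *\<^sub>R outer z z"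
    using complex_add_cnj[of c]
    by (simp add: vec_eq_iff outer_simps complex_scaleR flip: distrib_right)
  then show ?thesis unfolding dcproj_def s a_def[symmetric] by (simp only:) simp
qed

lemma dcproj_horizontal:
  assumes "v \<in> horizontal z"
  shows "dcproj z v = (1 / (norm z)\<^sup>2) *\<^sub>R (outer v z + outer z v)"
proof -
  have "z \<bullet> v = 0" using assms Re_hprod[of v z] by (simp add: horizontal_def inner_commute)
  then show ?thesis by (simp add: dcproj_def)
qed

lemma subspace_horizontal: "subspace (horizontal z)"
  by (auto simp: subspace_def horizontal_def hprod_simps cdot_simps) (simp_all add: hprod_def cdot_def)

lemma horizontal_scale: "v \<in> horizontal z \<Longrightarrow> c *s v \<in> horizontal z"
  by (simp add: horizontal_def hprod_simps cdot_simps)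

lemma hprod_self_nonzero: "z \<noteq> 0 \<Longrightarrow> hprod z z \<noteq> 0"
  by (simp add: hprod_self)

text \<open>Removing the Hermitian component along \<open>z\<close> is invisible to
  \<open>dcproj z\<close>, and it preserves the second horizontality condition because
  \<open>z\<close> is null.\<close>

lemma dcproj_horizontal_part:
  assumes "null_vec z" "cdot v z = 0"
  obtains w where "w \<in> horizontal z" "dcproj z w = dcproj z v"
proof
  let ?c = "hprod v z / hprod z z"
  have z: "z \<noteq> 0" using assms(1) by (simp add: null_vec_def)
  show "v - ?c *s z \<in> horizontal z"
    using assms hprod_self_nonzero[OF z] by (simp add: horizontal_def hprod_simps cdot_simps null_vec_def)
  show "dcproj z (v - ?c *s z) = dcproj z v"
    using linear_diff[OF bounded_linear.linear[OF bounded_linear_dcproj[OF z]]] dcproj_scale_self[OF z] by simp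
qed

section \<open>Tangent spaces of the quadric and their dimension\<close>

lemma dcproj_in_tangent_space:
  assumes "null_vec z" "v \<in> horizontal z"
  shows "dcproj z v \<in> tangent_space quadric (cproj z)"
proof -
  have z: "z \<noteq> 0" "cdot z z = 0" "cdot v z = 0" "hprod v z = 0" "cdot z v = 0"
    using assms by (auto simp: null_vec_def horizontal_def cdot_commute)
  \<comment> \<open>The quadratic correction along \<open>conj_vec z\<close> keeps the curve \<open>\<zeta>\<close> in the null cone.\<close>
  define \<kappa> where "\<kappa> = cdot v v / (2 * hprod z z)"
  define \<zeta> where "\<zeta> = (\<lambda>t::real. z + t *\<^sub>R v - (t * t) *\<^sub>R (\<kappa> *s conj_vec z))"
  have conj: "cdot (conj_vec z) (conj_vec z) = 0" "cdot (conj_vec z) v = 0" "cdot v (conj_vec z) = 0"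
    using z by (simp_all add: cdot_conj_vec hprod_conj_vec cdot_commute[of "conj_vec z" v])
  have "cdot (\<zeta> t) (\<zeta> t) = 0" for t
    using hprod_self_nonzero[OF z(1)]
    by (simp add: \<zeta>_def cdot_simps hprod_simps hprod_conj_vec z conj cdot_commute[of "conj_vec z" z] cdot_conj_vec \<kappa>_def)
  moreover have nz: "\<zeta> t \<noteq> 0" for t
  proof -
    \<comment> \<open>Both \<open>v\<close> and \<open>conj_vec z\<close> are Hermitian-orthogonal
      to \<open>z\<close>, so the component of the curve along \<open>z\<close> never
      changes.\<close>
    have "hprod (\<zeta> t) z = hprod z z" by (simp add: \<zeta>_def hprod_simps z hprod_conj_vec)
    then show ?thesis using hprod_self_nonzero[OF z(1)] by (auto simp: hprod_def)
  qed
  ultimately have "cproj (\<zeta> t) \<in> quadric" for t by (simp add: quadric_eq null_vec_def)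
  moreover have "smooth_on UNIV (\<lambda>t. cproj (\<zeta> t))"
  proof -
    have sm: "smooth_on UNIV \<zeta>"
      unfolding \<zeta>_def
      by (intro smooth_on_diff smooth_on_add open_UNIV smooth_on_const smooth_on_bounded_linear
          bounded_linear_scaleR_left
          smooth_on_compose_linear[OF bounded_linear_scaleR_left, of _ "\<lambda>t. t * t"]
          smooth_on_bilinear[OF bounded_bilinear_mult] bounded_linear_ident)
    have "(\<lambda>t. cproj (\<zeta> t)) = (\<lambda>t. inverse (\<zeta> t \<bullet> \<zeta> t) *\<^sub>R outer (\<zeta> t) (\<zeta> t))"
      by (auto simp: cproj_def power2_norm_eq_inner divide_inverse)
    then show ?thesis
      by (simp only:) (intro smooth_on_bilinear[OF bounded_bilinear_scaleR] smooth_on_inverse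
          smooth_on_bilinear[OF bounded_bilinear_inner] smooth_on_bilinear[OF bounded_bilinear_outer]
          open_UNIV sm, use nz in simp)
  qed
  moreover have "((\<lambda>t. cproj (\<zeta> t)) has_vector_derivative dcproj z v) (at 0)"
  proof -
    have "(\<zeta> has_derivative (\<lambda>t. t *\<^sub>R v)) (at 0)"
      unfolding \<zeta>_def by (auto intro!: derivative_eq_intros)
    from has_derivative_compose[OF this, of cproj "dcproj z"] has_derivative_cproj[OF z(1)]
    show ?thesis
      using linear_scale[OF bounded_linear.linear[OF bounded_linear_dcproj[OF z(1)]]]
      by (simp add: has_vector_derivative_def \<zeta>_def)
  qed
  ultimately have "curve_germ quadric (cproj z) (dcproj z v) (\<lambda>t. cproj (\<zeta> t))"
    unfolding curve_germ_def by (auto intro!: exI[of _ 1] intro: smooth_on_subset simp: \<zeta>_def)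
  then show ?thesis unfolding tangent_space_def by blast
qed

lemma bounded_linear_mult_vec: "bounded_linear (\<lambda>A. A *v (z::complex^'n))"
proof -
  have "linear (\<lambda>A. A *v (z::complex^'n))"
    by (auto intro!: linearI simp: matrix_vector_mult_add_rdistrib scaleR_mult_vec)
  then show ?thesis by (simp add: linear_conv_bounded_linear)
qed

lemma bounded_bilinear_cdot: "bounded_bilinear cdot"
  by (rule bilinear_conv_bounded_bilinear[THEN iffD1])
    (auto simp: bilinear_def cdot_simps complex_scaleR intro!: linearI)

lemma tangent_space_quadric:
  fixes z :: "complex^'n"
  assumes "null_vec z"
  shows "tangent_space quadric (cproj z) = dcproj z ` horizontal z"
proof
  show "dcproj z ` horizontal z \<subseteq> tangent_space quadric (cproj z)"
    using dcproj_in_tangent_space[OF assms] by blast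
  show "tangent_space quadric (cproj z) \<subseteq> dcproj z ` horizontal z"
  proof
    fix X assume X: "X \<in> tangent_space quadric (cproj z)"
    have z: "z \<noteq> 0" "cdot z z = 0" using assms by (auto simp: null_vec_def)
    \<comment> \<open>For \<open>q\<close> in the quadric, \<open>q *v z\<close> lies on the line
      that \<open>q\<close> represents. Thus \<open>L\<close> recovers homogeneous coordinates near
      \<open>cproj z\<close>, and \<open>cproj\<close> composed with \<open>L\<close> is the
      identity there.\<close>
    define L where "L = (\<lambda>A::complex^'n^'n. A *v z)"
    have L: "bounded_linear L" unfolding L_def by (rule bounded_linear_mult_vec)
    have Lp: "L (cproj z) = z" using z by (simp add: L_def cproj_mult_vec hprod_self)
    have ex: "\<exists>c w. null_vec w \<and> q = cproj w \<and> L q = c *s w" if q: "q \<in> quadric" for q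
    proof -
      obtain w where "null_vec w" "q = cproj w" using q by (auto simp: quadric_eq)
      then show ?thesis unfolding L_def using cproj_mult_vec by blast
    qed
    have "has_tderiv quadric (\<lambda>q. q) (cproj z) (\<lambda>X. dcproj z (L X))"
      unfolding has_tderiv_def
    proof (intro exI conjI ballI)
      have "open (L -` (- {0}))"
        by (intro open_vimage linear_continuous_on[OF L]) auto
      then show "open {A. L A \<noteq> 0}" by (simp add: vimage_def)
      show "((\<lambda>A. cproj (L A)) has_derivative (\<lambda>X. dcproj z (L X))) (at (cproj z))"
        using has_derivative_compose[OF bounded_linear_imp_has_derivative[OF L], of cproj "dcproj z"]
          has_derivative_cproj[OF z(1)] by (simp add: Lp)
      fix q assume q: "q \<in> quadric \<inter> {A. L A \<noteq> 0}"
      then obtain c w where cw: "null_vec w" "q = cproj w" "L q = c *s w" using ex by blast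
      then have "cproj w = cproj (c *s w)" using q by (subst cproj_eq_iff) (auto simp: null_vec_def)
      then show "cproj (L q) = q" using cw by simp
    qed (use Lp z in simp)
    from tderiv_eq[OF this X] tderiv_eq[OF has_tderiv_id X]
    have eq: "X = dcproj z (L X)" by simp
    \<comment> \<open>The null equation for the recovered coordinates holds on all of the quadric;
      differentiating it gives the second horizontality condition for \<open>L X\<close>.\<close>
    have D1: "has_tderiv quadric (\<lambda>q. cdot (L q) (L q)) (cproj z) (\<lambda>X. cdot z (L X) + cdot (L X) z)"
    proof -
      have "has_tderiv quadric L (cproj z) L"
        using has_tderiv_linear[OF L has_tderiv_id] .
      then show ?thesis
        using has_tderiv_bilinear[OF bounded_bilinear_cdot, of quadric L "cproj z" L L L] assms
        by (simp add: Lp quadric_eq)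
    qed
    have D2: "has_tderiv quadric (\<lambda>q. cdot (L q) (L q)) (cproj z) (\<lambda>X. 0)"
      unfolding has_tderiv_def
    proof (intro exI conjI ballI)
      show "((\<lambda>q. 0) has_derivative (\<lambda>X. 0)) (at (cproj z))" by simp
      fix q :: "complex^'n^'n"
      assume "q \<in> quadric \<inter> UNIV"
      then obtain c w where "null_vec w" "L q = c *s w" using ex by blast
      then show "0 = cdot (L q) (L q)" by (simp add: cdot_simps null_vec_def)
    qed auto
    have "cdot z (L X) + cdot (L X) z = 0" using tderiv_eq[OF D1 X] tderiv_eq[OF D2 X] by simp
    then have "cdot (L X) z = 0" by (simp add: cdot_commute)
    then show "X \<in> dcproj z ` horizontal z"
      by (metis eq imageI dcproj_horizontal_part[OF assms])
  qed
qed

lemma tangent_space_quadricE: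
  assumes "p \<in> quadric"
  obtains z where "null_vec z" "p = cproj z" "tangent_space quadric p = dcproj z ` horizontal z"
  using assms tangent_space_quadric by (auto simp: quadric_eq)

lemma subspace_tangent_space_quadric:
  assumes "p \<in> quadric" shows "subspace (tangent_space quadric p)"
  using assms
  by (metis tangent_space_quadricE linear_subspace_image subspace_horizontal bounded_linear.linear
      bounded_linear_dcproj null_vec_def)

text \<open>The two complex conditions say that \<open>v\<close> is real-orthogonal to
  \<open>z\<close>, \<open>conj_vec z\<close> and their multiples by \<open>\<i>\<close>. These four
  vectors are nonzero and pairwise orthogonal, since a null vector is Hermitian-orthogonal to its
  conjugate.\<close>

lemma dim_horizontal:
  fixes z :: "complex^'n"
  assumes "null_vec z"
  shows "dim (horizontal z) + 4 = 2 * CARD('n)"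
proof -
  have z: "z \<noteq> 0" "cdot z z = 0" using assms by (auto simp: null_vec_def)
  define B where "B = {z, \<i> *s z, conj_vec z, \<i> *s conj_vec z}"
  have nn: "hprod z z \<noteq> 0" using hprod_self_nonzero[OF z(1)] .
  have n: "hprod (conj_vec z) (conj_vec z) = hprod z z" by (simp add: hprod_conj_vec cdot_conj_vec cdot_commute[of "conj_vec z"])
  have h: "hprod z (conj_vec z) = 0" "hprod (conj_vec z) z = 0" using z by (simp_all add: hprod_conj_vec)
  have hh: "Re (hprod z z) \<noteq> 0" "Im (hprod z z) = 0" using z(1) by (simp_all add: hprod_self)
  have orth: "pairwise orthogonal B"
    unfolding pairwise_def orthogonal_def B_def Re_hprod[symmetric]
    by (auto simp: hprod_simps n h hh)
  have d: "u \<noteq> v" if "hprod u v = 0" "hprod u u \<noteq> 0" for u v :: "complex^'n" using that by auto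
  have ii: "x = 0" if "x = \<i> * x" for x :: complex
  proof -
    have "x = \<i> * (\<i> * x)" using that by metis
    then show ?thesis by simp
  qed
  have ne: "z \<noteq> \<i> *s z" "conj_vec z \<noteq> \<i> *s conj_vec z"
  proof -
    show "z \<noteq> \<i> *s z"
    proof
      assume "z = \<i> *s z"
      then have "hprod z z = \<i> * hprod z z" by (metis hprod_simps(5))
      then show False using nn ii by blast
    qed
    show "conj_vec z \<noteq> \<i> *s conj_vec z"
    proof
      assume "conj_vec z = \<i> *s conj_vec z"
      then have "hprod z z = \<i> * hprod z z" by (metis hprod_simps(5) n)
      then show False using nn ii by blast
    qed
  qed
  have ne2: "z \<noteq> conj_vec z" "z \<noteq> \<i> *s conj_vec z" "\<i> *s z \<noteq> conj_vec z" "\<i> *s z \<noteq> \<i> *s conj_vec z"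
    by (rule d; simp add: hprod_simps h nn)+
  have card: "card B = 4" unfolding B_def using ne ne2 by simp
  have "hprod u u \<noteq> 0" if "u \<in> B" for u
    using that n nn by (auto simp: B_def hprod_simps)
  then have "0 \<notin> B" by (force simp: hprod_def)
  then have ind: "independent B" using pairwise_orthogonal_independent[OF orth] by blast
  have "dim (span B) = 4" using card dim_eq_card_independent[OF ind] by (simp add: dim_span)
  moreover have "horizontal z = {y \<in> UNIV. \<forall>x \<in> span B. orthogonal x y}"
  proof -
    have "y \<in> horizontal z \<longleftrightarrow> (\<forall>x\<in>B. orthogonal y x)" for y
      unfolding B_def horizontal_def orthogonal_def Re_hprod[symmetric]
      by (auto simp: hprod_simps hprod_conj_vec complex_eq_iff)
    moreover have "(\<forall>x\<in>B. orthogonal y x) \<longleftrightarrow> (\<forall>x\<in>span B. orthogonal x y)" for y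
      using span_minimal[OF _ subspace_orthogonal_to_vector[of y], of B] span_superset[of B]
      by (auto simp: orthogonal_commute)
    ultimately show ?thesis by auto
  qed
  moreover have "dim {y \<in> UNIV. \<forall>x \<in> span B. orthogonal x y} + dim (span B) = dim (UNIV :: (complex^'n) set)"
    by (rule dim_subspace_orthogonal_to_vectors) auto
  ultimately show ?thesis by simp
qed

lemma dim_tangent_space_quadric:
  fixes p :: "complex^'n^'n"
  assumes "p \<in> quadric"
  shows "dim (tangent_space quadric p) + 4 \<le> 2 * CARD('n)"
proof -
  obtain z where z: "null_vec z" "tangent_space quadric p = dcproj z ` horizontal z"
    using assms tangent_space_quadricE by metis
  then have "dim (dcproj z ` horizontal z) \<le> dim (horizontal z)"
    by (intro dim_image_le bounded_linear.linear bounded_linear_dcproj) (simp add: null_vec_def)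
  then show ?thesis using dim_horizontal[OF z(1)] z(2) by simp
qed

section \<open>Metric and complex structure on tangent spaces\<close>

lemma fubini_study_horizontal:
  assumes "z \<noteq> 0" "v \<in> horizontal z"
  shows "fubini_study (dcproj z v) (dcproj z w) = Re (hprod v w / (norm z)\<^sup>2)"
  using fubini_study_dcproj[OF assms(1)] assms(2) by (simp add: horizontal_def)

lemma bounded_bilinear_fubini_study: "bounded_bilinear fubini_study"
  unfolding fubini_study_def divide_inverse
  by (rule bounded_bilinear.comp1[OF bounded_bilinear_inner,
      of "\<lambda>x. x", simplified] bilinear_conv_bounded_bilinear[THEN iffD1];
      auto simp: bilinear_def inner_simps algebra_simps intro!: linearI)+

lemma bounded_bilinear_complex_structure: "bounded_bilinear complex_structure"
proof (rule bilinear_conv_bounded_bilinear[THEN iffD1])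
  show "bilinear (complex_structure :: complex^'n^'n \<Rightarrow> _)"
    unfolding bilinear_def
    by (auto intro!: linearI simp: complex_structure_def vec_eq_iff matrix_matrix_mult_def
        sum.distrib sum_subtractf sum_distrib_left complex_scaleR algebra_simps)
qed

text \<open>On horizontal lifts the complex structure is multiplication by \<open>\<i>\<close>,
  which preserves \<open>horizontal z\<close> and the Hermitian product.\<close>

lemma complex_structure_tangent:
  assumes "p \<in> quadric" "X \<in> tangent_space quadric p"
  shows "complex_structure p X \<in> tangent_space quadric p"
    and "complex_structure p (complex_structure p X) = - X"
    and "Y \<in> tangent_space quadric p \<Longrightarrow>
      fubini_study (complex_structure p X) (complex_structure p Y) = fubini_study X Y"
proof -
  obtain z where z: "null_vec z" "p = cproj z" "tangent_space quadric p = dcproj z ` horizontal z"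
    using assms tangent_space_quadricE by metis
  have z0: "z \<noteq> 0" using z by (simp add: null_vec_def)
  obtain v where v: "v \<in> horizontal z" "X = dcproj z v" using assms z by auto
  have J: "complex_structure p (dcproj z u) = dcproj z (\<i> *s u)" for u
    using complex_structure_cproj[OF z0] z by simp
  show "complex_structure p X \<in> tangent_space quadric p" using v z(3) J by (simp add: horizontal_scale)
  have "\<i> *s (\<i> *s v) = - v" by (simp add: vec_eq_iff)
  then show "complex_structure p (complex_structure p X) = - X"
    using v J linear_neg[OF bounded_linear.linear[OF bounded_linear_dcproj[OF z0]]] by simp
  assume "Y \<in> tangent_space quadric p"
  then obtain w where w: "w \<in> horizontal z" "Y = dcproj z w" using z by auto
  show "fubini_study (complex_structure p X) (complex_structure p Y) = fubini_study X Y"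
    using v w by (simp add: J fubini_study_horizontal[OF z0] horizontal_scale hprod_simps)
qed

lemma bounded_bilinear_matrix_mult: "bounded_bilinear ((**) :: complex^'n^'n \<Rightarrow> complex^'n^'n \<Rightarrow> complex^'n^'n)"
  by (rule bilinear_conv_bounded_bilinear[THEN iffD1])
    (auto simp: bilinear_def vec_eq_iff matrix_matrix_mult_def sum.distrib scaleR_sum_right algebra_simps intro!: linearI)

text \<open>The adjoint of multiplication by a matrix is multiplication by its conjugate transpose,
  which for Hermitian \<open>p\<close> is \<open>p\<close> again.\<close>

lemma inner_mult_hermitian:
  fixes p :: "complex^'n^'n"
  assumes "\<And>i j. p $ i $ j = cnj (p $ j $ i)"
  shows "(A ** p) \<bullet> B = A \<bullet> (B ** p)" and "(p ** A) \<bullet> B = A \<bullet> (p ** B)"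
proof -
  have m: "(a * b) \<bullet> c = a \<bullet> (c * cnj b)" for a b c :: complex
    by (simp add: inner_complex_def algebra_simps)
  have "(A ** p) \<bullet> B = (\<Sum>i\<in>UNIV. \<Sum>j\<in>UNIV. \<Sum>k\<in>UNIV. A $ i $ k \<bullet> (B $ i $ j * cnj (p $ k $ j)))"
    by (simp add: inner_vec_def matrix_matrix_mult_def inner_sum_left m)
  also have "\<dots> = (\<Sum>i\<in>UNIV. \<Sum>k\<in>UNIV. \<Sum>j\<in>UNIV. A $ i $ k \<bullet> (B $ i $ j * p $ j $ k))"
    by (subst sum.swap) (simp flip: assms)
  also have "\<dots> = A \<bullet> (B ** p)"
    by (simp add: inner_vec_def matrix_matrix_mult_def inner_sum_right)
  finally show "(A ** p) \<bullet> B = A \<bullet> (B ** p)" .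
  have "(p ** A) \<bullet> B = (\<Sum>i\<in>UNIV. \<Sum>j\<in>UNIV. \<Sum>k\<in>UNIV. A $ k $ j \<bullet> (cnj (p $ i $ k) * B $ i $ j))"
    by (simp add: inner_vec_def matrix_matrix_mult_def inner_sum_left m mult.commute)
  also have "\<dots> = (\<Sum>i\<in>UNIV. \<Sum>k\<in>UNIV. \<Sum>j\<in>UNIV. A $ k $ j \<bullet> (p $ k $ i * B $ i $ j))"
    by (subst sum.swap) (simp flip: assms)
  also have "\<dots> = (\<Sum>k\<in>UNIV. \<Sum>j\<in>UNIV. \<Sum>i\<in>UNIV. A $ k $ j \<bullet> (p $ k $ i * B $ i $ j))"
    by (subst sum.swap) (subst (2) sum.swap, rule refl)
  also have "\<dots> = A \<bullet> (p ** B)"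
    by (simp add: inner_vec_def matrix_matrix_mult_def inner_sum_right)
  finally show "(p ** A) \<bullet> B = A \<bullet> (p ** B)" .
qed

lemma fubini_study_complex_structure_left:
  fixes p :: "complex^'n^'n"
  assumes "p \<in> quadric"
  shows "fubini_study (complex_structure p A) B = - fubini_study A (complex_structure p B)"
proof -
  have her: "p $ i $ j = cnj (p $ j $ i)" for i j
    using assms cproj_hermitian by (auto simp: quadric_eq)
  have i: "(\<chi> i j. \<i> * A $ i $ j) \<bullet> B = - (A \<bullet> (\<chi> i j. \<i> * B $ i $ j))" for A B :: "complex^'n^'n"
    by (simp add: inner_vec_def inner_complex_def sum_negf[symmetric] algebra_simps)
  have c: "(\<chi> i j. \<i> * (B ** p - p ** B) $ i $ j) =
      (\<chi> i j. \<i> * B $ i $ j) ** p - p ** (\<chi> i j. \<i> * B $ i $ j)" for B :: "complex^'n^'n"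
    by (simp add: vec_eq_iff matrix_matrix_mult_def sum_distrib_left algebra_simps)
  have c1: "(\<chi> i j. \<i> * (B ** p) $ i $ j) = (\<chi> i j. \<i> * B $ i $ j) ** p"
    and c2: "(\<chi> i j. \<i> * (p ** B) $ i $ j) = p ** (\<chi> i j. \<i> * B $ i $ j)" for B :: "complex^'n^'n"
    by (simp_all add: vec_eq_iff matrix_matrix_mult_def sum_distrib_left algebra_simps)
  show ?thesis
    unfolding fubini_study_def complex_structure_def c
    by (simp add: inner_diff_left inner_diff_right inner_mult_hermitian[OF her] i c1 c2)
      (simp add: field_simps)
qed

text \<open>This is \<open>\<nabla>J = 0\<close>: the derivative of \<open>complex_structure\<close> in its base point has no
  tangential part.\<close>

lemma fubini_study_complex_structure_tangent:
  fixes p :: "complex^'n^'n"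
  assumes "p \<in> quadric" "X \<in> tangent_space quadric p" "N \<in> tangent_space quadric p" "Y \<in> tangent_space quadric p"
  shows "fubini_study (complex_structure X N) Y = 0"
proof -
  obtain z where z: "null_vec z" "tangent_space quadric p = dcproj z ` horizontal z"
    using assms tangent_space_quadricE by metis
  obtain x n y where v: "x \<in> horizontal z" "n \<in> horizontal z" "y \<in> horizontal z"
     "X = dcproj z x" "N = dcproj z n" "Y = dcproj z y" using assms z by auto
  define a where "a = 1 / (norm z)\<^sup>2"
  have d: "X = a *\<^sub>R (outer x z + outer z x)" "N = a *\<^sub>R (outer n z + outer z n)" "Y = a *\<^sub>R (outer y z + outer z y)"
    using v dcproj_horizontal by (auto simp: a_def)
  have h: "hprod u z = 0" "hprod z u = 0" if "u \<in> horizontal z" for u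
    using that cnj_hprod[of u z] by (auto simp: horizontal_def)
  have m: "outer a b ** outer c d = outer (hprod c b *s a) d" for a b c d :: "complex^'n"
    by (simp add: mult_outer_right outer_mult_vec)
  define I where "I A = (\<chi> i j. \<i> * A $ i $ j)" for A :: "complex^'n^'n"
  have I: "I (A + B) = I A + I B" "I (A - B) = I A - I B" "I (outer a b) = outer (\<i> *s a) b"
    for A B :: "complex^'n^'n" and a b :: "complex^'n"
    by (simp_all add: I_def vec_eq_iff outer_simps algebra_simps)
  have cs: "complex_structure A B = I (B ** A - A ** B)" for A B :: "complex^'n^'n"
    by (simp add: complex_structure_def I_def)
  have z0: "outer 0 b = 0" for b :: "complex^'n" by (simp add: outer_def vec_eq_iff)
  \<comment> \<open>Relative to the line of \<open>z\<close> and its orthogonal complement, tangent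
    matrices are block off-diagonal. Products of two of them are block diagonal, hence orthogonal to
    a third.\<close>
  have "complex_structure (outer x z + outer z x) (outer n z + outer z n) \<bullet> (outer y z + outer z y) = 0"
    unfolding cs
    by (simp add: bounded_bilinear.add_left[OF bounded_bilinear_matrix_mult]
          bounded_bilinear.add_right[OF bounded_bilinear_matrix_mult] m h v z0 I inner_add_left inner_add_right
          inner_diff_left inner_outer hprod_simps)
  then show ?thesis
    unfolding d fubini_study_def
    by (simp add: bounded_bilinear.scaleR_left[OF bounded_bilinear_complex_structure]
         bounded_bilinear.scaleR_right[OF bounded_bilinear_complex_structure])
qed

section \<open>Projection of matrices onto the tangent spaces of the quadric\<close>

definition adjoint_matrix :: "complex^'n^'n \<Rightarrow> complex^'n^'n" where
  "adjoint_matrix A = (\<chi> i j. cnj (A $ j $ i))"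

text \<open>For \<open>q = cproj z\<close> with \<open>null_vec z\<close>, the matrices \<open>q\<close> and \<open>transpose q\<close> are the orthogonal projections onto
  the lines of \<open>z\<close> and of its conjugate, and \<open>horizontal z\<close> is the range of the complementary projection.\<close>

definition tangent_proj :: "complex^'n^'n \<Rightarrow> complex^'n^'n \<Rightarrow> complex^'n^'n" where
  "tangent_proj q A = (mat 1 - q - transpose q) ** A ** q
     + adjoint_matrix ((mat 1 - q - transpose q) ** A ** q)"

text \<open>The factor \<open>q\<close> on the right retains only the value \<open>A *v z\<close>,
  the left factor makes this value horizontal, and adding the adjoint produces the symmetric shape
  of \<open>dcproj z w\<close>.\<close>

lemma tangent_proj_cproj:
  fixes z :: "complex^'n"
  assumes "null_vec z"
  shows "\<exists>w\<in>horizontal z. tangent_proj (cproj z) A = dcproj z w \<and>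
    w = A *v z - (hprod (A *v z) z / (norm z)\<^sup>2) *s z - (cdot (A *v z) z / (norm z)\<^sup>2) *s conj_vec z"
proof (intro bexI conjI)
  have z: "z \<noteq> 0" "cdot z z = 0" using assms by (auto simp: null_vec_def)
  let ?w = "A *v z - (hprod (A *v z) z / (norm z)\<^sup>2) *s z - (cdot (A *v z) z / (norm z)\<^sup>2) *s conj_vec z"
  show w: "?w \<in> horizontal z"
    using z by (simp add: horizontal_def hprod_simps cdot_simps hprod_self hprod_conj_vec
       cdot_commute[of "conj_vec z" z] cdot_conj_vec)
  have r: "(mat 1 - cproj z - transpose (cproj z)) *v (A *v z) = ?w"
    by (simp add: matrix_vector_mult_diff_rdistrib cproj_mult_vec transpose_cproj_mult_vec
        del: transpose_matrix_vector)
  have o: "R ** A ** cproj z = (1 / (norm z)\<^sup>2) *\<^sub>R outer (R *v (A *v z)) z" for R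
  proof -
    have s: "X ** (r *\<^sub>R Y) = r *\<^sub>R (X ** Y)" for X Y :: "complex^'n^'n" and r
      by (simp add: vec_eq_iff matrix_matrix_mult_def scaleR_sum_right)
    show ?thesis by (simp add: cproj_def s mult_outer_right matrix_vector_mul_assoc)
  qed
  have a: "adjoint_matrix (r *\<^sub>R outer u v) = r *\<^sub>R outer v u" for r and u v :: "complex^'n"
    by (simp add: adjoint_matrix_def outer_def vec_eq_iff complex_scaleR mult.commute)
  show "tangent_proj (cproj z) A = dcproj z ?w"
    unfolding tangent_proj_def o r a dcproj_horizontal[OF w] by (simp add: scaleR_right_distrib)
qed simp

lemma tangent_proj_in_tangent_space:
  assumes "q \<in> quadric"
  shows "tangent_proj q A \<in> tangent_space quadric q"
  using assms tangent_proj_cproj tangent_space_quadricE by (metis imageI)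

lemma tangent_proj_eq:
  assumes "q \<in> quadric" "X \<in> tangent_space quadric q"
  shows "tangent_proj q X = X"
proof -
  obtain z where z: "null_vec z" "q = cproj z" "tangent_space quadric q = dcproj z ` horizontal z"
    using assms tangent_space_quadricE by metis
  have z0: "z \<noteq> 0" using z by (simp add: null_vec_def)
  obtain v where v: "v \<in> horizontal z" "X = dcproj z v" using assms z by auto
  have v0: "hprod v z = 0" "hprod z v = 0" "cdot v z = 0"
    using v cnj_hprod[of v z] by (auto simp: horizontal_def)
  \<comment> \<open>A tangent matrix sends \<open>z\<close> to its own horizontal lift, so both
    correction terms of the projection vanish.\<close>
  have "X *v z = v"
    using z0 by (simp add: v dcproj_horizontal scaleR_mult_vec matrix_vector_mult_add_rdistrib outer_mult_vec
        v0 hprod_self vec_eq_iff complex_scaleR)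
  then show ?thesis using tangent_proj_cproj[OF z(1), of X] v0 v z by auto
qed

lemma bounded_linear_adjoint_matrix: "bounded_linear adjoint_matrix"
proof -
  have "linear (adjoint_matrix :: complex^'n^'n \<Rightarrow> _)"
    by (auto intro!: linearI simp: adjoint_matrix_def vec_eq_iff complex_scaleR)
  then show ?thesis by (simp add: linear_conv_bounded_linear)
qed

lemma bounded_linear_transpose: "bounded_linear (transpose :: complex^'n^'n \<Rightarrow> complex^'n^'n)"
proof -
  have "linear (transpose :: complex^'n^'n \<Rightarrow> complex^'n^'n)"
    by (auto intro!: linearI simp: transpose_def vec_eq_iff)
  then show ?thesis by (simp add: linear_conv_bounded_linear)
qed

lemma smooth_map_on_tangent_proj:
  assumes "smooth_map_on M f"
  shows "smooth_map_on M (\<lambda>q. tangent_proj q (f q))"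
  unfolding tangent_proj_def
  by (intro smooth_map_on_add smooth_map_on_diff smooth_map_on_linear[OF bounded_linear_adjoint_matrix]
      smooth_map_on_bilinear[OF bounded_bilinear_matrix_mult] smooth_map_on_const smooth_map_on_id
      smooth_map_on_linear[OF bounded_linear_transpose] assms)

lemma smooth_on_imp_smooth_map_on: "open U \<Longrightarrow> smooth_on U h \<Longrightarrow> smooth_map_on (M \<inter> U) h"
  by (rule smooth_map_onI) auto

section \<open>Hypersurfaces\<close>

lemma fubini_study_commute: "fubini_study X Y = fubini_study Y X"
  by (simp add: fubini_study_def inner_commute)

lemma fubini_study_simps:
  "fubini_study (X + Y) Z = fubini_study X Z + fubini_study Y Z"
  "fubini_study Z (X + Y) = fubini_study Z X + fubini_study Z Y"
  "fubini_study (X - Y) Z = fubini_study X Z - fubini_study Y Z"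
  "fubini_study Z (X - Y) = fubini_study Z X - fubini_study Z Y"
  "fubini_study (- X) Z = - fubini_study X Z"
  "fubini_study Z (- X) = - fubini_study Z X"
  "fubini_study (r *\<^sub>R X) Z = r * fubini_study X Z"
  "fubini_study Z (r *\<^sub>R X) = r * fubini_study Z X"
  "fubini_study 0 Z = 0"
  "fubini_study Z 0 = 0"
  by (simp_all add: fubini_study_def inner_simps diff_divide_distrib add_divide_distrib)

lemma fubini_study_eq_0_iff: "fubini_study X X = 0 \<longleftrightarrow> X = 0"
  by (simp add: fubini_study_def)

lemma vector_field_Int_open:
  assumes "vector_field (M \<inter> V) X" "open V" "p \<in> M" "p \<in> V"
  obtains D where "has_tderiv M X p D" "X p \<in> tangent_space M p"
proof -
  have "smooth_map_on (M \<inter> V) X" "X p \<in> tangent_space M p"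
    using assms tangent_space_Int_open[OF assms(2,4), of M] by (auto simp: vector_field_def)
  then show ?thesis using that smooth_map_on_has_tderiv assms(2-4) by blast
qed

lemma vector_field_quadric_Int:
  assumes "smooth_map_on (quadric \<inter> V) f" "open V"
  shows "vector_field (quadric \<inter> V) (\<lambda>q. tangent_proj q (f q))"
  using smooth_map_on_tangent_proj[OF assms(1)] tangent_proj_in_tangent_space
    tangent_space_Int_open[OF assms(2)] by (auto simp: vector_field_def)

lemma tderiv_fubini_study:
  assumes "has_tderiv M X p D" "has_tderiv M Y p E" "p \<in> M" "v \<in> tangent_space M p"
  shows "tderiv M (\<lambda>q. fubini_study (X q) (Y q)) p v = fubini_study (X p) (E v) + fubini_study (D v) (Y p)"
  using tderiv_eq[OF has_tderiv_bilinear[OF bounded_bilinear_fubini_study assms(1-3)] assms(4)] .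

section \<open>Levi-Civita connection and shape operator of the quadric\<close>

lemma levi_civita_in_tangent_space:
  assumes "levi_civita M g nabla" "open V" "vector_field (M \<inter> V) Y" "p \<in> M \<inter> V" "x \<in> tangent_space M p"
  shows "nabla p x Y \<in> tangent_space M p"
proof -
  have "affine_connection M nabla" using assms(1) by (simp add: levi_civita_def)
  from this[unfolded affine_connection_def, rule_format, OF assms(2,3), THEN conjunct1, THEN bspec, OF assms(4)]
  show ?thesis using assms(5) by (elim conjE) (rule bspec)
qed

lemma levi_civita_torsion_free_metric:
  assumes "levi_civita M g nabla" "open V" "vector_field (M \<inter> V) Y" "vector_field (M \<inter> V) Z" "p \<in> M \<inter> V"
  shows "nabla p (Y p) Z - nabla p (Z p) Y = lie_bracket M Y Z p"
    and "v \<in> tangent_space M p \<Longrightarrow>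
      tderiv M (\<lambda>q. g (Y q) (Z q)) p v = g (nabla p v Y) (Z p) + g (Y p) (nabla p v Z)"
proof -
  note * = assms(1)[unfolded levi_civita_def, THEN conjunct2, rule_format, OF assms(2-5)]
  show "nabla p (Y p) Z - nabla p (Z p) Y = lie_bracket M Y Z p"
    by (rule *[THEN conjunct1])
  show "v \<in> tangent_space M p \<Longrightarrow>
      tderiv M (\<lambda>q. g (Y q) (Z q)) p v = g (nabla p v Y) (Z p) + g (Y p) (nabla p v Z)"
    by (rule *[THEN conjunct2, THEN bspec])
qed

text \<open>The Koszul formula: for a metric induced from a constant inner product, the Levi-Civita
  connection is the tangential part of the ambient derivative.\<close>

lemma levi_civita_quadric:
  assumes lc: "levi_civita quadric fubini_study nabla" and V: "open V" "p \<in> quadric" "p \<in> V"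
    and Y: "vector_field (quadric \<inter> V) Y" "has_tderiv quadric Y p D"
    and x: "x \<in> tangent_space quadric p" and z: "z \<in> tangent_space quadric p"
  shows "fubini_study (nabla p x Y) z = fubini_study (D x) z"
proof -
  let ?T = "tangent_space quadric p" and ?g = fubini_study
  define X where "X = (\<lambda>q. tangent_proj q x)"
  define Z where "Z = (\<lambda>q. tangent_proj q z)"
  have X: "vector_field (quadric \<inter> V) X" and Z: "vector_field (quadric \<inter> V) Z"
    unfolding X_def Z_def by (intro vector_field_quadric_Int smooth_map_on_const V)+
  have p: "X p = x" "Z p = z" using tangent_proj_eq[OF V(2)] x z by (auto simp: X_def Z_def)
  obtain E where E: "has_tderiv quadric X p E" using vector_field_Int_open[OF X V] .
  obtain F where F: "has_tderiv quadric Z p F" using vector_field_Int_open[OF Z V] .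
  define y where "y = Y p"
  have y: "y \<in> ?T" using vector_field_Int_open[OF Y(1) V] y_def by metis
  have m: "?g (A p) (D2 v) + ?g (D1 v) (B p) = ?g (nabla p v A) (B p) + ?g (A p) (nabla p v B)"
    if "vector_field (quadric \<inter> V) A" "vector_field (quadric \<inter> V) B"
      "has_tderiv quadric A p D1" "has_tderiv quadric B p D2" "v \<in> ?T" for A B D1 D2 v
  proof -
    have "tderiv quadric (\<lambda>q. ?g (A q) (B q)) p v = ?g (nabla p v A) (B p) + ?g (A p) (nabla p v B)"
      using levi_civita_torsion_free_metric(2)[OF lc V(1) that(1,2) _ that(5)] V by simp
    then show ?thesis using tderiv_fubini_study[OF that(3,4) V(2) that(5)] by simp
  qed
  have t: "nabla p (A p) B - nabla p (B p) A = D2 (A p) - D1 (B p)"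
    if "vector_field (quadric \<inter> V) A" "vector_field (quadric \<inter> V) B"
      "has_tderiv quadric A p D1" "has_tderiv quadric B p D2" "A p \<in> ?T" "B p \<in> ?T" for A B D1 D2
  proof -
    have "nabla p (A p) B - nabla p (B p) A = lie_bracket quadric A B p"
      using levi_civita_torsion_free_metric(1)[OF lc V(1) that(1,2)] V by simp
    then show ?thesis
      using tderiv_eq[OF that(3) that(6)] tderiv_eq[OF that(4) that(5)] by (simp add: lie_bracket_def)
  qed
  note m1 = m[OF Y(1) Z Y(2) F x] and m2 = m[OF Z X F E y] and m3 = m[OF X Y(1) E Y(2) z]
  have t1: "nabla p x Y - nabla p y X = D x - E y" using t[OF X Y(1) E Y(2)] x y p y_def by simp
  have t2: "nabla p x Z - nabla p z X = F x - E z" using t[OF X Z E F] x z p by simp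
  have t3: "nabla p y Z - nabla p z Y = F y - D z" using t[OF Y(1) Z Y(2) F] y z p y_def by simp
  \<comment> \<open>Paired with tangent vectors, \<open>nabla\<close> and the ambient derivative
    satisfy the same metric and torsion identities. Their difference is symmetric in two arguments
    and skew in two, hence zero; the linear arithmetic performs this cancellation.\<close>
  note t' = t1[THEN arg_cong, of "\<lambda>w. ?g w z"] t2[THEN arg_cong, of "\<lambda>w. ?g w y"] t3[THEN arg_cong, of "\<lambda>w. ?g w x"]
  show ?thesis
    using m1 m2 m3 t' unfolding p y_def[symmetric] fubini_study_simps
      fubini_study_commute[of x] fubini_study_commute[of y] fubini_study_commute[of z]
    by linarith
qed

text \<open>Every admissible extension of \<open>N\<close> has the same ambient derivative as
  \<open>N\<close> along vectors tangent to \<open>M\<close>, so the choice in \<open>shape\<close>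
  does not matter. The test vector \<open>y\<close> ranges over the tangent space of the quadric,
  since it will be \<open>J\<close> of a vector tangent to \<open>M\<close>.\<close>

lemma shape_props:
  assumes lc: "levi_civita quadric fubini_study nabla" and M: "M \<subseteq> quadric" "unit_normal_field M N"
    and p: "p \<in> M" and D: "has_tderiv M N p D" and x: "x \<in> tangent_space M p"
  shows "shape nabla M N p x \<in> tangent_space quadric p"
    and "y \<in> tangent_space quadric p \<Longrightarrow> fubini_study (shape nabla M N p x) y = - fubini_study (D x) y"
proof -
  define ext where "ext N' V \<longleftrightarrow> open V \<and> p \<in> V \<and> vector_field (quadric \<inter> V) N' \<and> (\<forall>q\<in>M \<inter> V. N' q = N q)" for N' V
  define N' where "N' = (SOME N'. \<exists>V. ext N' V)"
  have "\<exists>N' V. ext N' V"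
  proof -
    obtain U h where U: "open U" "p \<in> U" "smooth_on U h" "\<forall>q\<in>M \<inter> U. h q = N q"
      using M(2) p unfolding unit_normal_field_def smooth_map_on_def by blast
    \<comment> \<open>Projecting an ambient extension makes it tangent to the quadric, and the
      projection fixes the values \<open>N q\<close>, which are tangent already.\<close>
    have "ext (\<lambda>q. tangent_proj q (h q)) U"
      unfolding ext_def using U M
      by (auto intro!: vector_field_quadric_Int smooth_on_imp_smooth_map_on tangent_proj_eq simp: unit_normal_field_def)
    then show ?thesis by blast
  qed
  then have "\<exists>V. ext N' V" unfolding N'_def by (rule someI_ex)
  then obtain V where V: "open V" "p \<in> V" "vector_field (quadric \<inter> V) N'" "\<forall>q\<in>M \<inter> V. N' q = N q"
    unfolding ext_def by blast
  have pQ: "p \<in> quadric" using p M by blast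
  have xQ: "x \<in> tangent_space quadric p" using tangent_space_mono[OF M(1)] x by blast
  have s: "shape nabla M N p x = - nabla p x N'"
    by (simp add: shape_def N'_def ext_def)
  obtain E where E: "has_tderiv quadric N' p E" using vector_field_Int_open[OF V(3,1) pQ V(2)] .
  have "has_tderiv M N p E"
    by (rule has_tderiv_cong[OF has_tderiv_mono[OF E M(1)] V(1,2)]) (use V(4) in auto)
  then have DE: "D x = E x" using tderiv_eq[OF D x] tderiv_eq[OF _ x] by metis
  show "shape nabla M N p x \<in> tangent_space quadric p"
    unfolding s using levi_civita_in_tangent_space[OF lc V(1,3)] pQ V(2) xQ
      subspace_neg[OF subspace_tangent_space_quadric[OF pQ]] by blast
  show "fubini_study (shape nabla M N p x) y = - fubini_study (D x) y" if "y \<in> tangent_space quadric p"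
    unfolding s DE fubini_study_simps
    using levi_civita_quadric[OF lc V(1) pQ V(2,3) E xQ that] by simp
qed

text \<open>Here \<open>M\<close> plays the role of a piece \<open>M \<inter> V\<close> carrying a
  unit normal field. Tangent spaces are assumed by linearity and dimension, properties that pass to
  open pieces at once; \<open>m \<ge> 1\<close> keeps \<open>2 * m - 1\<close> from being
  truncated.\<close>

locale quadric_hypersurface =
  fixes m :: nat
    and nabla :: "complex^'n^'n \<Rightarrow> complex^'n^'n \<Rightarrow> (complex^'n^'n \<Rightarrow> complex^'n^'n) \<Rightarrow> complex^'n^'n"
    and M :: "(complex^'n^'n) set" and N :: "complex^'n^'n \<Rightarrow> complex^'n^'n"
  assumes card: "CARD('n) = m + 2" and m: "m \<ge> 1"
    and lc: "levi_civita quadric fubini_study nabla"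
    and M_sub: "M \<subseteq> quadric" and N: "unit_normal_field M N"
    and subspace_tangent: "p \<in> M \<Longrightarrow> subspace (tangent_space M p)"
    and dim_tangent: "p \<in> M \<Longrightarrow> dim (tangent_space M p) = 2 * m - 1"
begin

text \<open>Otherwise \<open>x\<close> and \<open>N p\<close> would enlarge the tangent space of
  \<open>M\<close> from dimension \<open>2 * m - 1\<close> to \<open>2 * m + 1\<close>, inside a
  tangent space of the quadric of dimension at most \<open>2 * m\<close>.\<close>

lemma tangent_spaceI:
  assumes p: "p \<in> M" and x: "x \<in> tangent_space quadric p" "fubini_study (N p) x = 0"
  shows "x \<in> tangent_space M p"
proof (rule ccontr)
  assume "x \<notin> tangent_space M p"
  let ?T = "tangent_space M p"
  have span: "span ?T = ?T" using subspace_tangent[OF p] by (simp add: span_eq_iff)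
  have "dim (insert x ?T) = 2 * m"
    using dim_insert[of x ?T] span \<open>x \<notin> ?T\<close> dim_tangent[OF p] m by simp
  moreover have "N p \<notin> span (insert x ?T)"
  proof
    assume "N p \<in> span (insert x ?T)"
    moreover have "subspace {v. fubini_study (N p) v = 0}"
      by (auto simp: subspace_def fubini_study_simps)
    moreover have "insert x ?T \<subseteq> {v. fubini_study (N p) v = 0}"
      using x N p by (auto simp: unit_normal_field_def)
    ultimately have "fubini_study (N p) (N p) = 0" using span_minimal by blast
    then show False using N p by (simp add: unit_normal_field_def)
  qed
  ultimately have "dim (insert (N p) (insert x ?T)) = 2 * m + 1"
    using dim_insert[of "N p" "insert x ?T"] by simp
  moreover have "insert (N p) (insert x ?T) \<subseteq> tangent_space quadric p"
    using x N p tangent_space_mono[OF M_sub] by (auto simp: unit_normal_field_def)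
  then have "dim (insert (N p) (insert x ?T)) \<le> dim (tangent_space quadric p)"
    by (rule dim_subset)
  ultimately show False
    using dim_tangent_space_quadric[of p] p M_sub card by auto
qed

lemma tangent_vector_extension:
  assumes p: "p \<in> M" and y: "y \<in> tangent_space M p"
  obtains Y where "vector_field M Y" "Y p = y"
proof
  \<comment> \<open>The constant vector \<open>y\<close> is projected onto the tangent spaces of the
    quadric and then loses its normal component; at \<open>p\<close> neither operation changes
    it.\<close>
  define Y where "Y = (\<lambda>q. tangent_proj q y - fubini_study (N q) (tangent_proj q y) *\<^sub>R N q)"
  have sN: "smooth_map_on M N" using N by (simp add: unit_normal_field_def)
  have "smooth_map_on M Y"
    unfolding Y_def
    by (intro smooth_map_on_diff smooth_map_on_tangent_proj smooth_map_on_const sN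
        smooth_map_on_bilinear[OF bounded_bilinear_scaleR]
        smooth_map_on_bilinear[OF bounded_bilinear_fubini_study])
  moreover have "Y q \<in> tangent_space M q" if q: "q \<in> M" for q
  proof (rule tangent_spaceI[OF q])
    have qQ: "q \<in> quadric" using q M_sub by blast
    show "Y q \<in> tangent_space quadric q"
      unfolding Y_def using N q
      by (intro subspace_diff subspace_scale subspace_tangent_space_quadric tangent_proj_in_tangent_space qQ)
        (auto simp: unit_normal_field_def)
    show "fubini_study (N q) (Y q) = 0"
      using N q by (simp add: Y_def fubini_study_simps unit_normal_field_def)
  qed
  ultimately show "vector_field M Y" by (simp add: vector_field_def)
  have "tangent_proj p y = y"
    using tangent_proj_eq p y M_sub tangent_space_mono[OF M_sub] by blast
  then show "Y p = y" using N p y by (simp add: Y_def unit_normal_field_def)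
qed

lemma normal_facts:
  assumes p: "p \<in> M"
  shows "p \<in> quadric" "N p \<in> tangent_space quadric p" "fubini_study (N p) (N p) = 1"
    and "x \<in> tangent_space M p \<Longrightarrow> fubini_study (N p) x = 0"
    and "x \<in> tangent_space M p \<Longrightarrow> x \<in> tangent_space quadric p"
  using N p M_sub tangent_space_mono[OF M_sub] by (auto simp: unit_normal_field_def)

section \<open>Reeb field and structure Lie operator\<close>

lemma reeb_facts:
  assumes p: "p \<in> M"
  shows "reeb N p \<in> tangent_space M p" "fubini_study (reeb N p) (reeb N p) = 1"
    and "complex_structure p (reeb N p) = N p"
proof -
  note n = normal_facts[OF p]
  note J = complex_structure_tangent[OF n(1,2)]
  have "fubini_study (N p) (complex_structure p (N p)) = 0"
    using fubini_study_complex_structure_left[OF n(1), of "N p" "N p"]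
      fubini_study_commute[of "N p" "complex_structure p (N p)"] by simp
  then show "reeb N p \<in> tangent_space M p"
    using J(1) n(1) by (intro tangent_spaceI[OF p])
      (auto simp: reeb_def fubini_study_simps intro: subspace_neg[OF subspace_tangent_space_quadric])
  show "fubini_study (reeb N p) (reeb N p) = 1"
    using J(3)[OF n(2)] n(3) by (simp add: reeb_def fubini_study_simps)
  show "complex_structure p (reeb N p) = N p"
    using J(2) by (simp add: reeb_def bounded_bilinear.minus_right[OF bounded_bilinear_complex_structure])
qed

lemma normal_has_tderiv:
  assumes "p \<in> M"
  obtains D where "has_tderiv M N p D"
  using smooth_map_on_has_tderiv[of M UNIV N p] N assms by (auto simp: unit_normal_field_def)

text \<open>\<open>complex_structure\<close> is linear also in its base point, so the product rule
  adds a term from the motion of \<open>p\<close>; this is the term without tangential part.\<close>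

lemma reeb_has_tderiv:
  assumes p: "p \<in> M" and D: "has_tderiv M N p D"
  shows "has_tderiv M (reeb N) p (\<lambda>v. - (complex_structure p (D v) + complex_structure v (N p)))"
proof -
  have "has_tderiv M (\<lambda>q. complex_structure q (N q)) p
      (\<lambda>v. complex_structure p (D v) + complex_structure v (N p))"
    by (rule has_tderiv_bilinear[OF bounded_bilinear_complex_structure has_tderiv_id D p])
  from has_tderiv_linear[OF bounded_linear_minus[OF bounded_linear_ident] this]
  show ?thesis unfolding reeb_def by simp
qed

text \<open>Since the metric is the restriction of a constant bilinear form,
  \<open>(\<L>\<^sub>\<xi> g)(x, y) = g(D\<^sub>x \<xi>, y) + g(x, D\<^sub>y \<xi>)\<close> with the ambient derivative \<open>D\<close>.\<close>

lemma structure_lie_operator_eqI: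
  assumes p: "p \<in> M" and D: "has_tderiv M (reeb N) p D"
    and x: "x \<in> tangent_space M p" and u: "u \<in> tangent_space M p"
    and eq: "\<And>y. y \<in> tangent_space M p \<Longrightarrow> fubini_study u y = fubini_study (D x) y + fubini_study x (D y)"
  shows "structure_lie_operator M N p x = u"
proof -
  let ?\<xi> = "reeb N p"
  note \<xi> = reeb_facts(1)[OF p]
  have ld: "lie_derivative_metric M fubini_study (reeb N) X Y p
      = fubini_study (D (X p)) (Y p) + fubini_study (X p) (D (Y p))"
    if f: "open V" "p \<in> V" "vector_field (M \<inter> V) X" "vector_field (M \<inter> V) Y" for V X Y
  proof -
    obtain E where E: "has_tderiv M X p E" "X p \<in> tangent_space M p"
      using vector_field_Int_open[OF f(3,1) p f(2)] .
    obtain F where F: "has_tderiv M Y p F" "Y p \<in> tangent_space M p"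
      using vector_field_Int_open[OF f(4,1) p f(2)] .
    show ?thesis
      unfolding lie_derivative_metric_def lie_bracket_def tderiv_fubini_study[OF E(1) F(1) p \<xi>]
        tderiv_eq[OF E(1) \<xi>] tderiv_eq[OF F(1) \<xi>] tderiv_eq[OF D E(2)] tderiv_eq[OF D F(2)]
      by (simp add: fubini_study_simps)
  qed
  show ?thesis
    unfolding structure_lie_operator_def
  proof (rule the_equality)
    show "u \<in> tangent_space M p \<and>
        (\<forall>V X Y. open V \<longrightarrow> p \<in> V \<longrightarrow> vector_field (M \<inter> V) X \<longrightarrow> vector_field (M \<inter> V) Y \<longrightarrow> X p = x \<longrightarrow>
           fubini_study u (Y p) = lie_derivative_metric M fubini_study (reeb N) X Y p)"
      using u eq ld vector_field_Int_open p by metis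
    fix u' assume u': "u' \<in> tangent_space M p \<and>
        (\<forall>V X Y. open V \<longrightarrow> p \<in> V \<longrightarrow> vector_field (M \<inter> V) X \<longrightarrow> vector_field (M \<inter> V) Y \<longrightarrow> X p = x \<longrightarrow>
           fubini_study u' (Y p) = lie_derivative_metric M fubini_study (reeb N) X Y p)"
    then have w: "u' - u \<in> tangent_space M p"
      using u subspace_diff[OF subspace_tangent[OF p]] by blast
    obtain X where X: "vector_field M X" "X p = x" using tangent_vector_extension[OF p x] .
    \<comment> \<open>Uniqueness: the difference of two candidates is tested against a field through
      that very difference, which gives its squared length.\<close>
    obtain Y where Y: "vector_field M Y" "Y p = u' - u" using tangent_vector_extension[OF p w] .
    have "fubini_study u' (Y p) = lie_derivative_metric M fubini_study (reeb N) X Y p"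
      using u' X Y by (metis Int_UNIV_right UNIV_I open_UNIV)
    also have "\<dots> = fubini_study u (Y p)"
      using ld[of UNIV X Y] X Y eq[OF w] by simp
    finally have "fubini_study (u' - u) (u' - u) = 0" by (simp add: Y fubini_study_simps)
    then show "u' = u" by (simp add: fubini_study_eq_0_iff)
  qed
qed

text \<open>Linearity does not come with the definite description; this value is what remains of the
  second term of the tensor once \<open>T_\<xi> \<xi> = 0\<close>.\<close>

lemma structure_lie_operator_zero:
  assumes p: "p \<in> M"
  shows "structure_lie_operator M N p 0 = 0"
proof -
  obtain D where "has_tderiv M N p D" using normal_has_tderiv[OF p] .
  note D = reeb_has_tderiv[OF p this]
  show ?thesis
    using subspace_0[OF subspace_tangent[OF p]] linear_0[OF has_tderiv_imp_linear[OF D]]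
    by (intro structure_lie_operator_eqI[OF p D]) (auto simp: fubini_study_simps)
qed

lemma shape_reeb:
  assumes p: "p \<in> M"
  defines "s \<equiv> shape nabla M N p (reeb N p)"
  shows "s \<in> tangent_space M p"
    and "phi N p s \<in> tangent_space M p"
    and "structure_lie_operator M N p (reeb N p) = phi N p s"
proof -
  obtain D where D: "has_tderiv M N p D" using normal_has_tderiv[OF p] .
  define E where "E = (\<lambda>v. - (complex_structure p (D v) + complex_structure v (N p)))"
  have E: "has_tderiv M (reeb N) p E" unfolding E_def by (rule reeb_has_tderiv[OF p D])
  note n = normal_facts[OF p] and \<xi> = reeb_facts[OF p]
  note sh = shape_props[OF lc M_sub N p D \<xi>(1), folded s_def]
  \<comment> \<open>A field of constant length is orthogonal to its derivative. For \<open>N\<close>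
    this makes \<open>S \<xi>\<close> tangent to \<open>M\<close>; for \<open>\<xi>\<close> it
    removes one of the two terms of the Lie derivative.\<close>
  have const: "fubini_study (A p) (F v) = 0" if "has_tderiv M A p F" "v \<in> tangent_space M p"
     "\<And>q. q \<in> M \<Longrightarrow> fubini_study (A q) (A q) = 1" for A F v
  proof -
    have "has_tderiv M (\<lambda>q. fubini_study (A q) (A q)) p (\<lambda>v. 0)"
      unfolding has_tderiv_def using that(3) by (intro exI[of _ UNIV] exI[of _ "\<lambda>q. 1"]) auto
    from tderiv_eq[OF this that(2)] tderiv_fubini_study[OF that(1,1) p that(2)]
    show ?thesis by (simp add: fubini_study_commute[of "F v"])
  qed
  have sN: "fubini_study (N p) s = 0"
    using sh(2)[OF n(2)] const[OF D \<xi>(1) normal_facts(3)]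
    by (simp add: fubini_study_commute[of "N p"])
  show s: "s \<in> tangent_space M p" by (rule tangent_spaceI[OF p sh(1) sN])
  have "fubini_study (N p) (complex_structure p s) = fubini_study s (reeb N p)"
    using fubini_study_complex_structure_left[OF n(1), of "N p" s]
    by (simp add: reeb_def fubini_study_simps fubini_study_commute[of s])
  then have "fubini_study (N p) (phi N p s) = 0"
    by (simp add: phi_def eta_def fubini_study_simps n(3))
  moreover have "phi N p s \<in> tangent_space quadric p"
    unfolding phi_def using complex_structure_tangent(1)[OF n(1) sh(1)] n(2)
    by (intro subspace_diff subspace_scale subspace_tangent_space_quadric n(1))
  ultimately show \<phi>: "phi N p s \<in> tangent_space M p" by (intro tangent_spaceI[OF p])
  show "structure_lie_operator M N p (reeb N p) = phi N p s"
  proof (rule structure_lie_operator_eqI[OF p E \<xi>(1) \<phi>])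
    fix y assume y: "y \<in> tangent_space M p"
    have yQ: "y \<in> tangent_space quadric p" using n(5)[OF y] .
    have "fubini_study (phi N p s) y = fubini_study (complex_structure p s) y"
      using n(4)[OF y] by (simp add: phi_def fubini_study_simps)
    also have "\<dots> = - fubini_study s (complex_structure p y)"
      by (rule fubini_study_complex_structure_left[OF n(1)])
    also have "\<dots> = fubini_study (D (reeb N p)) (complex_structure p y)"
      using sh(2)[OF complex_structure_tangent(1)[OF n(1) yQ]] by simp
    \<comment> \<open>Skewness of \<open>J\<close> moves it back onto the derivative of
      \<open>N\<close>, and the term from the varying base point is orthogonal to
      \<open>y\<close>.\<close>
    also have "\<dots> = fubini_study (E (reeb N p)) y"
      unfolding E_def
      using fubini_study_complex_structure_left[OF n(1), of "D (reeb N p)" y]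
        fubini_study_complex_structure_tangent[OF n(1) n(5)[OF \<xi>(1)] n(2) yQ]
      by (simp add: fubini_study_simps)
    finally show "fubini_study (phi N p s) y = fubini_study (E (reeb N p)) y + fubini_study (reeb N p) (E y)"
      using const[OF E y reeb_facts(2)] by simp
  qed
qed

lemma phi_orthogonal_reeb:
  assumes p: "p \<in> M" and x: "x \<in> tangent_space M p"
  shows "fubini_study (phi N p x) (reeb N p) = 0"
proof -
  note n = normal_facts[OF p] and \<xi> = reeb_facts[OF p]
  have "fubini_study (complex_structure p x) (reeb N p) = 0"
    using fubini_study_complex_structure_left[OF n(1)] \<xi>(3) n(4)[OF x] fubini_study_commute[of x] by simp
  then show ?thesis using n(4)[OF \<xi>(1)] by (simp add: phi_def fubini_study_simps)
qed

lemma phi_reeb: "p \<in> M \<Longrightarrow> phi N p (reeb N p) = 0"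
  using reeb_facts[of p] by (simp add: phi_def eta_def)

lemma shape_reeb_principal:
  assumes p: "p \<in> M" and zero: "lie_torsion_tensor k nabla M N p (reeb N p) (reeb N p) = 0"
  shows "shape nabla M N p (reeb N p) = eta N p (shape nabla M N p (reeb N p)) *\<^sub>R reeb N p"
proof -
  define s where "s = shape nabla M N p (reeb N p)"
  note sh = shape_reeb[OF p, folded s_def] and n = normal_facts[OF p] and \<xi> = reeb_facts[OF p]
  have e1: "eta N p (reeb N p) = 1" using \<xi>(2) by (simp add: eta_def)
  have "torsion_operator k nabla M N p (reeb N p) (phi N p s) = 0"
    using zero sh(3) structure_lie_operator_zero[OF p]
    by (simp add: lie_torsion_tensor_def torsion_operator_def)
  then have "fubini_study (torsion_operator k nabla M N p (reeb N p) (phi N p s)) (reeb N p) = 0"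
    by (simp add: fubini_study_simps)
  \<comment> \<open>Pairing with \<open>\<xi>\<close> kills \<open>\<phi> s\<close>,
    \<open>\<phi> (\<phi> s)\<close> and \<open>\<phi> \<xi>\<close>; the two remaining terms of the
    second Cho operator cancel since \<open>\<xi>\<close> has unit length and
    \<open>\<eta>(\<xi>) = 1\<close>.\<close>
  then have "fubini_study (phi N p s) (phi N p s) = 0"
    unfolding torsion_operator_def cho_operator_def s_def[symmetric] fubini_study_simps e1 phi_reeb[OF p] \<xi>(2)
      phi_orthogonal_reeb[OF p sh(1)] phi_orthogonal_reeb[OF p sh(2)]
    by simp
  then have "complex_structure p s = eta N p s *\<^sub>R N p"
    by (simp add: fubini_study_eq_0_iff phi_def)
  \<comment> \<open>As \<open>J\<close> squares to \<open>-1\<close> on the tangent spaces of the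
    quadric and \<open>J N = -\<xi>\<close>, a second application of \<open>J\<close> recovers
    \<open>s\<close>.\<close>
  then have "complex_structure p (complex_structure p s) = eta N p s *\<^sub>R complex_structure p (N p)"
    by (simp add: bounded_bilinear.scaleR_right[OF bounded_bilinear_complex_structure])
  then have "s = eta N p s *\<^sub>R reeb N p"
    using complex_structure_tangent(2)[OF n(1) n(5)[OF sh(1)]] by (simp add: reeb_def) (metis minus_equation_iff)
  then show ?thesis by (simp add: s_def)
qed

end

theorem theorem1p4:
  fixes m :: nat and k :: real
    and nabla :: "complex^'n^'n \<Rightarrow> complex^'n^'n \<Rightarrow> (complex^'n^'n \<Rightarrow> complex^'n^'n) \<Rightarrow> complex^'n^'n"
  assumes "m \<ge> 3" and "CARD('n) = m + 2" and "k \<noteq> 0"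
    and "levi_civita quadric fubini_study nabla"
  shows "\<not> (\<exists>M :: (complex^'n^'n) set.
           M \<subseteq> quadric \<and> smooth_submanifold (2 * m - 1) M \<and>
           \<not> hopf nabla M \<and>
           (\<forall>p\<in>M. \<exists>V N. open V \<and> p \<in> V \<and> unit_normal_field (M \<inter> V) N \<and>
              (\<forall>q\<in>M \<inter> V. \<forall>X\<in>tangent_space M q.
                 lie_torsion_tensor k nabla (M \<inter> V) N q (reeb N q) X = 0)))"
proof clarify
  fix M :: "(complex^'n^'n) set"
  assume M: "M \<subseteq> quadric" "smooth_submanifold (2 * m - 1) M" and "\<not> hopf nabla M"
    and *: "\<forall>p\<in>M. \<exists>V N. open V \<and> p \<in> V \<and> unit_normal_field (M \<inter> V) N \<and>
              (\<forall>q\<in>M \<inter> V. \<forall>X\<in>tangent_space M q.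
                 lie_torsion_tensor k nabla (M \<inter> V) N q (reeb N q) X = 0)"
  have "hopf nabla M"
    unfolding hopf_def
  proof
    fix p assume "p \<in> M"
    then obtain V N where V: "open V" "p \<in> V" and N: "unit_normal_field (M \<inter> V) N"
      and zero: "\<And>q X. q \<in> M \<inter> V \<Longrightarrow> X \<in> tangent_space M q \<Longrightarrow>
         lie_torsion_tensor k nabla (M \<inter> V) N q (reeb N q) X = 0"
      using * by metis
    have T: "tangent_space (M \<inter> V) q = tangent_space M q" if "q \<in> V" for q
      using tangent_space_Int_open[OF V(1) that] .
    interpret quadric_hypersurface m nabla "M \<inter> V" N
      by unfold_locales (use assms M N T tangent_space_submanifold[OF M(2)] in auto)
    \<comment> \<open>The principal function is forced to be \<open>\<eta>(S \<xi>)\<close>; the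
      vector inserted into the hypothesis is \<open>\<xi>\<close>, tangent to \<open>M\<close> by
      \<open>reeb_facts\<close>.\<close>
    have "shape nabla (M \<inter> V) N q (reeb N q) = eta N q (shape nabla (M \<inter> V) N q (reeb N q)) *\<^sub>R reeb N q"
      if "q \<in> M \<inter> V" for q
      using shape_reeb_principal[OF that zero[OF that]] reeb_facts(1)[OF that] T that by auto
    then show "\<exists>V N. open V \<and> p \<in> V \<and> unit_normal_field (M \<inter> V) N \<and>
        (\<exists>\<alpha>. \<forall>q\<in>M \<inter> V. shape nabla (M \<inter> V) N q (reeb N q) = \<alpha> q *\<^sub>R reeb N q)"
      using V N by (intro exI[of _ V] exI[of _ N] conjI
         exI[of _ "\<lambda>q. eta N q (shape nabla (M \<inter> V) N q (reeb N q))"]) auto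
  qed
  with \<open>\<not> hopf nabla M\<close> show False by simp
qed

end
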